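(* Let $1<\alpha<2$. Then the Hilbert matrix operator $\mathcal H$ is bounded on $\mathcal B^\alpha$ and $$\|\mathcal H\|_{\mathcal B^\alpha\to\mathcal B^\alpha}=C_\alpha+\sup_{0\le r<1}D_\alpha(r).$$ The norm-attaining functions of norm one (i.e. the $f\in\mathcal B^\alpha$ with $\|f\|_{\mathcal B^\alpha}=1$ and $\|\mathcal Hf\|_{\mathcal B^\alpha}=\|\mathcal H\|_{\mathcal B^\alpha\to\mathcal B^\alpha}$) are exactly the functions $f(z)=\lambda F_\alpha(z)$ with $\lambda\in\mathbb T$. Moreover, $$C_\alpha=\frac{1}{2(\alpha-1)}+\frac{\sqrt\pi\,\Gamma(1-\alpha)}{2\,\Gamma(3/2-\alpha)},$$ where the gamma quotient is interpreted by continuous extension at $\alpha=3/2$. If $1<\alpha\le 3/2$, then $$\|\mathcal H\|_{\mathcal B^\alpha\to\mathcal B^\alpha}=C_\alpha+\frac{\pi}{\sin(\pi(\alpha-1))}.$$ In particular, $\|\mathcal H\|_{\mathcal B^{3/2}\to\mathcal B^{3/2}}=1+\pi$. If $3/2<\alpha<2$, then $D_\alpha$ extends continuously to $[0,1]$ with $$D_\alpha(1)=\frac{\pi}{\sin(\pi(\alpha-1))},$$ but $$\sup_{0\le r<1}D_\alpha(r)>D_\alpha(1).$$ Consequently, the supremum $\sup_{0\le r<1}D_\alpha(r)$ is attained at an interior point $r_\alpha\in(0,1)$.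
   Context: Let $\mathbb D=\{z\in\mathbb C:|z|<1\}$ and $\mathbb T=\{\lambda\in\mathbb C:|\lambda|=1\}$. For $\alpha>0$, the $\alpha$-Bloch space $\mathcal B^\alpha$ consists of all analytic functions $f$ on $\mathbb D$ with $$\|f\|_{\mathcal B^\alpha}=|f(0)|+\sup_{z\in\mathbb D}(1-|z|^2)^\alpha|f'(z)|<\infty.$$ The Hilbert matrix operator is defined by $$\mathcal Hf(z)=\int_0^1\frac{f(t)}{1-tz}\,dt,\qquad z\in\mathbb D.$$ For $1<\alpha<2$, set $$P_\alpha(t)=\int_0^t(1-s^2)^{-\alpha}\,ds\quad(0\le t<1),\qquad C_\alpha=\int_0^1(1-t)(1-t^2)^{-\alpha}\,dt,$$ $$D_\alpha(r)=(1-r^2)^\alpha\int_0^1\frac{tP_\alpha(t)}{(1-rt)^2}\,dt\quad(0\le r<1),\qquad F_\alpha(z)=\int_0^z(1-\zeta^2)^{-\alpha}\,d\zeta\quad(z\in\mathbb D),$$ where $(1-z^2)^{-\alpha}$ denotes the analytic branch on $\mathbb D$ which is positive on $[0,1)$. $\Gamma$ is the Gamma function. $\|\mathcal H\|_{\mathcal B^\alpha\to\mathcal B^\alpha}$ is the operator norm. *)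

theory Defs
  imports "HOL-Complex_Analysis.Complex_Analysis"
begin

text \<open>Functions on the unit disc are total functions of type \<open>complex \<Rightarrow> complex\<close>; their values
  outside \<open>ball 0 1\<close> are irrelevant, so equality of two such functions always means equality
  on \<open>ball 0 1\<close>.\<close>

definition bloch_space :: "real \<Rightarrow> (complex \<Rightarrow> complex) set" where
  "bloch_space \<alpha> =
     {f. f holomorphic_on ball 0 1 \<and>
         bdd_above ((\<lambda>z. (1 - (cmod z)\<^sup>2) powr \<alpha> * cmod (deriv f z)) ` ball 0 1)}"

text \<open>Only meaningful on \<open>bloch_space \<alpha>\<close>, where the supremum is finite.\<close>

definition bloch_norm :: "real \<Rightarrow> (complex \<Rightarrow> complex) \<Rightarrow> real" where
  "bloch_norm \<alpha> f =
     cmod (f 0) + (SUP z\<in>ball 0 1. (1 - (cmod z)\<^sup>2) powr \<alpha> * cmod (deriv f z))"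

definition bloch_bounded ::
    "real \<Rightarrow> ((complex \<Rightarrow> complex) \<Rightarrow> (complex \<Rightarrow> complex)) \<Rightarrow> bool" where
  "bloch_bounded \<alpha> T \<longleftrightarrow>
     (\<forall>f\<in>bloch_space \<alpha>. T f \<in> bloch_space \<alpha>) \<and>
     (\<exists>K. \<forall>f\<in>bloch_space \<alpha>. bloch_norm \<alpha> (T f) \<le> K * bloch_norm \<alpha> f)"

text \<open>Only meaningful if \<open>bloch_bounded \<alpha> T\<close> holds (and \<open>T\<close> is linear).\<close>

definition bloch_opnorm ::
    "real \<Rightarrow> ((complex \<Rightarrow> complex) \<Rightarrow> (complex \<Rightarrow> complex)) \<Rightarrow> real" where
  "bloch_opnorm \<alpha> T = (SUP f\<in>{f \<in> bloch_space \<alpha>. bloch_norm \<alpha> f \<le> 1}. bloch_norm \<alpha> (T f))"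

definition hilbert_integrable :: "(complex \<Rightarrow> complex) \<Rightarrow> complex \<Rightarrow> bool" where
  "hilbert_integrable f z \<longleftrightarrow>
     set_integrable lborel {0..<1::real} (\<lambda>t. f (of_real t) / (1 - of_real t * z))"

definition hilbert_op :: "(complex \<Rightarrow> complex) \<Rightarrow> complex \<Rightarrow> complex" where
  "hilbert_op f z = (LINT t:{0..<1::real}|lborel. f (of_real t) / (1 - of_real t * z))"

definition P_fun :: "real \<Rightarrow> real \<Rightarrow> real" where
  "P_fun \<alpha> t = (LINT s:{0..t}|lborel. (1 - s\<^sup>2) powr (- \<alpha>))"

definition C_const :: "real \<Rightarrow> real" where
  "C_const \<alpha> = (LINT t:{0..<1}|lborel. (1 - t) * (1 - t\<^sup>2) powr (- \<alpha>))"

definition D_fun :: "real \<Rightarrow> real \<Rightarrow> real" where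
  "D_fun \<alpha> r =
     (1 - r\<^sup>2) powr \<alpha> * (LINT t:{0..<1}|lborel. t * P_fun \<alpha> t / (1 - r * t)\<^sup>2)"

text \<open>For \<open>\<zeta>\<close> in the unit disc \<open>1 - \<zeta>\<^sup>2\<close> has positive real part, so the principal power is the
  analytic branch of \<open>(1 - \<zeta>\<^sup>2)\<^bsup>-\<alpha>\<^esup>\<close> that is positive on \<open>[0,1)\<close>.\<close>

definition F_fun :: "real \<Rightarrow> complex \<Rightarrow> complex" where
  "F_fun \<alpha> z =
     contour_integral (linepath 0 z) (\<lambda>\<zeta>. (1 - \<zeta>\<^sup>2) powr (- complex_of_real \<alpha>))"

text \<open>The quotient \<open>\<Gamma>(1 - \<alpha>) / \<Gamma>(3/2 - \<alpha>)\<close>, continuously extended to \<open>\<alpha> = 3/2\<close>, where the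
  denominator has a pole.\<close>

definition gamma_quotient :: "real \<Rightarrow> real" where
  "gamma_quotient \<alpha> =
     (if \<alpha> = 3/2 then Lim (at (3/2)) (\<lambda>a. Gamma (1 - a) / Gamma (3/2 - a))
      else Gamma (1 - \<alpha>) / Gamma (3/2 - \<alpha>))"

lemma gamma_quotient_tendsto:
  "((\<lambda>a::real. Gamma (1 - a) / Gamma (3/2 - a)) \<longlongrightarrow> 0) (at (3/2))"
proof -
  have "(-1/2::real) \<notin> \<int>\<^sub>\<le>\<^sub>0"
  proof
    assume "(-1/2::real) \<in> \<int>\<^sub>\<le>\<^sub>0"
    then obtain n :: int where "(-1/2::real) = of_int n"
      by (auto elim!: nonpos_Ints_cases)
    then have "of_int (2 * n) = (of_int (-1) :: real)" by simp
    then have "2 * n = -1" by (simp only: of_int_eq_iff)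
    then show False by presburger
  qed
  then have "isCont (\<lambda>a::real. Gamma (1 - a) * rGamma (3/2 - a)) (3/2)"
    by (intro continuous_intros) auto
  then have "((\<lambda>a::real. Gamma (1 - a) * rGamma (3/2 - a)) \<longlongrightarrow> 0) (at (3/2))"
    by (simp add: isCont_def)
  then show ?thesis
    by (simp add: rGamma_inverse_Gamma field_simps)
qed

lemma gamma_quotient_isCont: "isCont gamma_quotient (3/2)"
proof -
  have "gamma_quotient (3/2) = 0"
    unfolding gamma_quotient_def using tendsto_Lim[OF _ gamma_quotient_tendsto] by simp
  moreover have "(gamma_quotient \<longlongrightarrow> 0) (at (3/2))"
    by (rule Lim_transform_eventually[OF gamma_quotient_tendsto])
       (auto simp: eventually_at_filter gamma_quotient_def)
  ultimately show ?thesis by (simp add: isCont_def)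
qed

end

theory Submission
  imports Defs
begin

text \<open>
  Write \<open>\<beta> = \<alpha> - 1\<close>, so \<open>0 < \<beta> < 1\<close>, write \<open>P\<close>, \<open>C\<close>, \<open>D\<close>, \<open>F\<close> for \<open>P_fun \<alpha>\<close>, \<open>C_const \<alpha>\<close>, \<open>D_fun \<alpha>\<close>,
  \<open>F_fun \<alpha>\<close>, and let \<open>S\<close> be the supremum of \<open>D\<close>.

  \<^emph>\<open>The norm.\<close>  A function \<open>f\<close> with Bloch seminorm \<open>s\<close> satisfies \<open>\<bar>f t\<bar> \<le> \<bar>f 0\<bar> + s * P t\<close> on \<open>[0,1)\<close>.
  Putting this into the integrals that give \<open>Hf 0\<close> and \<open>(Hf)'\<close>, and using \<open>\<integral>P = C\<close>, yields
  \<open>\<parallel>Hf\<parallel> \<le> 3 * \<bar>f 0\<bar> + s * (C + S)\<close> (\<open>hilbert_op_norm_bound\<close>).  Since \<open>S \<ge> \<pi> > 3\<close>, constants cannot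
  compete, and the norm is at most \<open>C + S\<close>.  For \<open>F\<close>, which has seminorm 1, vanishes at 0 and equals
  \<open>P\<close> on \<open>[0,1)\<close>, all estimates are equalities along the positive radius
  (\<open>extremal_function_norms\<close>).  Conversely, equality forces \<open>f 0 = 0\<close>, \<open>\<bar>f\<bar> \<le> P\<close> on \<open>[0,1)\<close> and
  \<open>\<bar>\<integral>f\<bar> = \<integral>P\<close>, hence \<open>f = c * P\<close> there for a unimodular \<open>c\<close>, and \<open>f = c * F\<close> on the disc by the
  identity theorem (\<open>extremal_function_unique\<close>).

  \<^emph>\<open>The function D.\<close>  Let \<open>h t = (1 - t\<^sup>2) powr (- \<beta>) / (2 * \<beta>) - t * P t\<close>, the defect between
  \<open>t * P t\<close> and its singular part.  Then \<open>h' = - P\<close>, so \<open>h\<close> decreases from \<open>1 / (2 * \<beta>)\<close> to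
  \<open>1 / (2 * \<beta>) - C\<close>.  An integration by parts evaluates this limit as
  \<open>(1 - 2 * \<beta>) * J / (2 * \<beta>)\<close>, where \<open>J = \<integral>\<^sub>0\<^sup>1 (1 - t\<^sup>2) powr (- \<beta>)\<close> is positive.  So the
  limit changes sign exactly at \<open>\<alpha> = 3/2\<close>; expressing \<open>J\<close> by Gamma functions also gives the closed
  form of \<open>C\<close>.  Three facts about \<open>D\<close> follow.

  \<^item> As \<open>r \<rightarrow> 1\<close> only the singular part contributes, and the substitution by the disc
    automorphism \<open>t = (r + u) / (1 + r * u)\<close> turns its contribution into a Beta integral with value
    \<open>\<pi> / sin (\<pi> * \<beta>)\<close> (\<open>D_fun_tendsto\<close>).

  \<^item> The derivative of \<open>D\<close> at \<open>r\<close> is \<open>(1 - r\<^sup>2) powr \<beta>\<close> times the integral of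
    \<open>P t * (1 - t\<^sup>2 + 2 * \<beta> * t * (t - r)) + 2 * \<beta> * t * h t\<close> against \<open>1 / (1 - r * t)\<^sup>2\<close>
    (\<open>D_fun_deriv\<close>).  For \<open>\<alpha> \<le> 3/2\<close> both summands are nonnegative, so \<open>D\<close> increases to its limit,
    which is the supremum.

  \<^item> Multiplied by \<open>1 - r\<close>, that integral tends to \<open>2 * \<beta> * h 1\<close> as \<open>r \<rightarrow> 1\<close>, because
    \<open>1 - t\<^sup>2\<close> and \<open>\<bar>t - r\<bar>\<close> are both \<open>O(1 - r * t)\<close>.  For \<open>\<alpha> > 3/2\<close> this is negative, so \<open>D\<close>
    decreases strictly to its limit near 1 and the supremum is larger; the derivative at 0 is
    positive, so the maximum of the continuous extension is attained strictly inside.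
\<close>

section \<open>Integration over the half-open unit interval\<close>
lemma set_integrable_continuous_bound:
  fixes f :: "real \<Rightarrow> 'a::{banach,second_countable_topology}" and g :: "real \<Rightarrow> real"
  assumes "continuous_on {0..<1} f" "set_integrable lborel {0..<1} g"
    and "\<And>t. t \<in> {0..<1} \<Longrightarrow> norm (f t) \<le> g t"
  shows "set_integrable lborel {0..<1} f"
proof (rule set_integrable_bound[OF assms(2)])
  show "set_borel_measurable lborel {0..<1} f"
    unfolding set_borel_measurable_def
    using borel_measurable_continuous_on_indicator[OF _ assms(1)] by simp
  show "AE x in lborel. x \<in> {0..<1} \<longrightarrow> norm (f x) \<le> norm (g x)"
    using assms(3) by (intro AE_I2 impI) (metis norm_ge_zero order_trans real_norm_def abs_of_nonneg)
qed

text \<open>Continuity on the closed interval makes the second factor bounded.\<close>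
lemma set_integrable_mult_continuous:
  fixes f :: "real \<Rightarrow> 'a::{real_normed_field,banach,second_countable_topology}"
  assumes f: "set_integrable lborel {0..<1} f" and \<phi>: "continuous_on {0..1} \<phi>"
  shows "set_integrable lborel {0..<1} (\<lambda>t. f t * \<phi> t)"
proof -
  have "bounded (\<phi> ` {0..1})" using \<phi> by (intro compact_imp_bounded compact_continuous_image) auto
  then obtain K where K: "\<And>t. t \<in> {0..1} \<Longrightarrow> norm (\<phi> t) \<le> K"
    unfolding bounded_iff by blast
  have \<phi>': "(\<lambda>t. indicator {0..<1} t *\<^sub>R \<phi> t) \<in> borel_measurable borel"
    using borel_measurable_continuous_on_indicator[OF _ continuous_on_subset[OF \<phi>], of "{0..<1}"]
    by (auto simp: subset_eq)
  have f': "(\<lambda>t. indicator {0..<1} t *\<^sub>R f t) \<in> borel_measurable borel"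
    using f by (auto simp: set_integrable_def)
  have "(\<lambda>t. (indicator {0..<1} t *\<^sub>R f t) * (indicator {0..<1} t *\<^sub>R \<phi> t)) \<in> borel_measurable borel"
    using f' \<phi>' by (rule borel_measurable_times)
  also have "(\<lambda>t. (indicator {0..<1} t *\<^sub>R f t) * (indicator {0..<1} t *\<^sub>R \<phi> t)) =
      (\<lambda>t. indicator {0..<1} t *\<^sub>R (f t * \<phi> t))"
    by (auto simp: indicator_def)
  finally have m: "set_borel_measurable lborel {0..<1} (\<lambda>t. f t * \<phi> t)"
    by (simp add: set_borel_measurable_def)
  have "set_integrable lborel {0..<1} (\<lambda>t. f t * of_real K)"
    using f by simp
  then show ?thesis
  proof (rule set_integrable_bound[OF _ m], intro AE_I2 impI)
    fix t :: real assume "t \<in> {0..<1}"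
    then have "norm (\<phi> t) \<le> \<bar>K\<bar>" using K[of t] by auto
    then show "norm (f t * \<phi> t) \<le> norm (f t * of_real K)"
      by (simp add: norm_mult mult_left_mono)
  qed
qed

lemma set_integral_dominated_convergence_within:
  fixes s :: "'c::first_countable_topology \<Rightarrow> real \<Rightarrow> 'a::{banach,second_countable_topology}"
  assumes s: "\<And>x. x \<in> S \<Longrightarrow> x \<noteq> a \<Longrightarrow> set_integrable lborel A (s x)"
    and f: "set_borel_measurable lborel A f"
    and w: "set_integrable lborel A w"
    and lim: "\<And>t. t \<in> A \<Longrightarrow> ((\<lambda>x. s x t) \<longlongrightarrow> f t) (at a within S)"
    and bound: "\<And>x t. x \<in> S \<Longrightarrow> x \<noteq> a \<Longrightarrow> t \<in> A \<Longrightarrow> norm (s x t) \<le> w t"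
  shows "((\<lambda>x. LINT t:A|lborel. s x t) \<longlongrightarrow> (LINT t:A|lborel. f t)) (at a within S)"
  unfolding tendsto_at_iff_sequentially
proof (intro allI impI)
  fix X :: "nat \<Rightarrow> 'c" assume X: "\<forall>i. X i \<in> S - {a}" "X \<longlonglongrightarrow> a"
  show "((\<lambda>x. LINT t:A|lborel. s x t) \<circ> X) \<longlonglongrightarrow> (LINT t:A|lborel. f t)"
    unfolding set_lebesgue_integral_def o_def
  proof (rule integral_dominated_convergence)
    show "integrable lborel (\<lambda>t. indicator A t *\<^sub>R w t)" using w by (simp add: set_integrable_def)
    show "(\<lambda>t. indicator A t *\<^sub>R f t) \<in> borel_measurable lborel"
      using f by (simp add: set_borel_measurable_def)
    show "(\<lambda>t. indicator A t *\<^sub>R s (X i) t) \<in> borel_measurable lborel" for i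
      using s[of "X i"] X(1) by (auto simp: set_integrable_def)
    show "AE t in lborel. (\<lambda>i. indicator A t *\<^sub>R s (X i) t) \<longlonglongrightarrow> indicator A t *\<^sub>R f t"
    proof (intro AE_I2)
      fix t
      show "(\<lambda>i. indicator A t *\<^sub>R s (X i) t) \<longlonglongrightarrow> indicator A t *\<^sub>R f t"
        using lim[of t] X by (cases "t \<in> A") (auto simp: tendsto_at_iff_sequentially o_def)
    qed
    show "AE t in lborel. norm (indicator A t *\<^sub>R s (X i) t) \<le> indicator A t *\<^sub>R w t" for i
      using bound[of "X i"] X(1) by (intro AE_I2) (auto simp: indicator_def)
  qed
qed

lemma tendsto_at_left_1_iff: "(f \<longlongrightarrow> l) (at 1 within {0..<1}) \<longleftrightarrow> (f \<longlongrightarrow> l) (at_left (1::real))"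
proof -
  have "at 1 within {0..<1} = at_left (1::real)"
    by (rule at_within_nhd[of _ "{0<..}"]) auto
  then show ?thesis by simp
qed

text \<open>Improper form of the fundamental theorem: the existence of the limit at the singular endpoint is
part of the conclusion, which is how the endpoint value of \<open>P_defect\<close> below is obtained.\<close>
lemma FTC_tendsto_at_left:
  fixes G g :: "real \<Rightarrow> real"
  assumes contG: "continuous_on {0..<1} G"
    and deriv: "\<And>t. 0 < t \<Longrightarrow> t < 1 \<Longrightarrow> (G has_real_derivative g t) (at t)"
    and g: "set_integrable lborel {0..<1} g"
  shows "(G \<longlongrightarrow> G 0 + (LINT t:{0..<1}|lborel. g t)) (at_left 1)"
proof -
  have gx: "set_integrable lborel {0..x} g" if "x \<in> {0..<1}" for x
    by (rule set_integrable_subset[OF g]) (use that in auto)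
  have FTC: "(LINT t:{0..x}|lborel. g t) = G x - G 0" if x: "x \<in> {0..<1}" for x
  proof -
    have "(g has_integral (G x - G 0)) {0..x}"
    proof (rule fundamental_theorem_of_calculus_interior)
      show "continuous_on {0..x} G" by (rule continuous_on_subset[OF contG]) (use x in auto)
      show "(G has_vector_derivative g t) (at t)" if "t \<in> {0<..<x}" for t
        using deriv[of t] that x by (auto simp: has_real_derivative_iff_has_vector_derivative)
    qed (use x in auto)
    then show ?thesis
      using set_borel_integral_eq_integral(2)[OF gx[OF x]] by (simp add: integral_unique)
  qed
  have lim: "((\<lambda>x. LINT t:{0..<1}|lborel. indicator {0..x} t *\<^sub>R g t) \<longlongrightarrow> (LINT t:{0..<1}|lborel. g t))
      (at 1 within {0..<1})"
  proof (rule set_integral_dominated_convergence_within)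
    show "set_integrable lborel {0..<1} (\<lambda>t. indicator {0..x} t *\<^sub>R g t)" if "x \<in> {0..<1}" for x
    proof -
      have "(\<lambda>t. indicator {0..<1} t *\<^sub>R indicator {0..x} t *\<^sub>R g t) = (\<lambda>t. indicator {0..x} t *\<^sub>R g t)"
        using that by (auto simp: indicator_def)
      then show ?thesis using gx[OF that] by (simp add: set_integrable_def)
    qed
    show "set_borel_measurable lborel {0..<1} g"
      using g by (simp add: set_integrable_def set_borel_measurable_def)
    show "set_integrable lborel {0..<1} (\<lambda>t. norm (g t))" using g by (simp add: set_integrable_abs)
    show "norm (indicator {0..x} t *\<^sub>R g t) \<le> norm (g t)" for x t by (simp add: indicator_def)
    show "((\<lambda>x. indicator {0..x} t *\<^sub>R g t) \<longlongrightarrow> g t) (at 1 within {0..<1})" if "t \<in> {0..<1}" for t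
    proof (rule tendsto_eventually)
      have "\<forall>\<^sub>F x in at 1 within {0..<1}. t < x"
        using order_tendstoD(1)[OF tendsto_ident_at, of t 1] that by auto
      then show "\<forall>\<^sub>F x in at 1 within {0..<1}. indicator {0..x} t *\<^sub>R g t = g t"
        by eventually_elim (use that in auto)
    qed
  qed
  have int_eq: "(LINT t:{0..<1}|lborel. indicator {0..x} t *\<^sub>R g t) = G x - G 0" if "x \<in> {0..<1}" for x
  proof -
    have "(\<lambda>t. indicator {0..<1} t *\<^sub>R indicator {0..x} t *\<^sub>R g t) = (\<lambda>t. indicator {0..x} t *\<^sub>R g t)"
      using that by (auto simp: indicator_def)
    then show ?thesis using FTC[OF that] by (simp add: set_lebesgue_integral_def)
  qed
  from lim have "((\<lambda>x. G x - G 0) \<longlongrightarrow> (LINT t:{0..<1}|lborel. g t)) (at 1 within {0..<1})"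
    by (rule Lim_transform_eventually) (use int_eq in \<open>auto simp: eventually_at_filter\<close>)
  then have "((\<lambda>x. G x - G 0) \<longlongrightarrow> (LINT t:{0..<1}|lborel. g t)) (at_left 1)"
    by (simp only: tendsto_at_left_1_iff)
  then have "((\<lambda>x. G x - G 0 + G 0) \<longlongrightarrow> (LINT t:{0..<1}|lborel. g t) + G 0) (at_left 1)"
    by (intro tendsto_add) auto
  then show ?thesis by (simp add: add.commute)
qed

corollary FTC_half_open:
  fixes G g :: "real \<Rightarrow> real"
  assumes "continuous_on {0..<1} G"
    and "\<And>t. 0 < t \<Longrightarrow> t < 1 \<Longrightarrow> (G has_real_derivative g t) (at t)"
    and "set_integrable lborel {0..<1} g" and "(G \<longlongrightarrow> L) (at_left 1)"
  shows "(LINT t:{0..<1}|lborel. g t) = L - G 0"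
  using tendsto_unique[OF _ assms(4) FTC_tendsto_at_left[OF assms(1-3)]] by simp

lemma set_integral_half_open_eq_closed:
  fixes f :: "real \<Rightarrow> real"
  assumes "set_integrable lborel {0..1} f"
  shows "(LINT t:{0..<1}|lborel. f t) = (LINT t:{0..1}|lborel. f t)"
proof (rule set_integral_cong_set)
  show "set_borel_measurable lborel {0..1} f"
    using assms by (simp add: set_integrable_def set_borel_measurable_def)
  have "set_integrable lborel {0..<1} f" by (rule set_integrable_subset[OF assms]) auto
  then show "set_borel_measurable lborel {0..<1} f"
    by (simp add: set_integrable_def set_borel_measurable_def)
  have "AE x in lborel. x \<noteq> (1::real)" by (rule AE_lborel_singleton)
  then show "AE x in lborel. (x \<in> {0..1}) = (x \<in> {0..<1::real})" by eventually_elim auto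
qed

lemma set_integral_Beta:
  fixes a b :: real
  assumes "a > 0" "b > 0"
  shows "set_integrable lborel {0..1} (\<lambda>t. t powr (a - 1) * (1 - t) powr (b - 1))"
    and "(LINT t:{0..1}|lborel. t powr (a - 1) * (1 - t) powr (b - 1)) = Beta a b"
proof -
  let ?f = "\<lambda>t::real. t powr (a - 1) * (1 - t) powr (b - 1)"
  have hi: "(?f has_integral Beta a b) {0..1}" by (rule has_integral_Beta_real[OF assms])
  then have "?f absolutely_integrable_on {0..1}"
    by (intro nonnegative_absolutely_integrable_1) (auto simp: integrable_on_def)
  then show 1: "set_integrable lborel {0..1} ?f"
    unfolding set_integrable_def by (subst (asm) integrable_completion) auto
  show "(LINT t:{0..1}|lborel. ?f t) = Beta a b"
    using set_borel_integral_eq_integral(2)[OF 1] hi by (simp add: integral_unique)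
qed

text \<open>A comparison with the Beta integral whose first exponent is 0.\<close>
lemma integrable_one_minus_powr:
  fixes b :: real assumes "b < 1"
  shows "set_integrable lborel {0..<1} (\<lambda>t. (1 - t) powr (- b))"
proof -
  have "set_integrable lborel {0..1} (\<lambda>t. t powr (1 - 1) * (1 - t) powr ((1 - b) - 1))"
    by (rule set_integral_Beta) (use assms in auto)
  then have "set_integrable lborel {0..<1} (\<lambda>t. t powr (1 - 1) * (1 - t) powr ((1 - b) - 1))"
    by (rule set_integrable_subset) auto
  then show ?thesis
  proof (rule set_integrable_bound)
    show "set_borel_measurable lborel {0..<1} (\<lambda>t. (1 - t) powr (- b))"
      by (simp add: set_borel_measurable_def)
    have "AE t in lborel. t \<noteq> (0::real)" by (rule AE_lborel_singleton)
    then show "AE t in lborel. t \<in> {0..<1} \<longrightarrow>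
        norm ((1 - t) powr (- b)) \<le> norm (t powr (1 - 1) * (1 - t) powr (1 - b - 1))"
      by eventually_elim auto
  qed
qed

section \<open>Cauchy-type integrals\<close>
lemma one_minus_norm_le_norm_one_minus:
  fixes w :: "'a::real_normed_field"
  assumes "0 \<le> t" "t \<le> 1" "norm w \<le> \<rho>"
  shows "1 - \<rho> \<le> norm (1 - of_real t * w)"
proof -
  have "norm (of_real t * w) \<le> \<rho>"
    using assms mult_left_le_one_le[of "norm w" t] by (simp add: norm_mult)
  then show ?thesis using norm_triangle_ineq2[of 1 "of_real t * w"] by simp
qed

lemma Cauchy_kernel_neq_0:
  fixes w :: "'a::real_normed_field"
  assumes "0 \<le> t" "t \<le> 1" "norm w < 1"
  shows "1 - of_real t * w \<noteq> 0"
  using one_minus_norm_le_norm_one_minus[OF assms(1,2) order.refl, of w] assms(3) by auto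

lemma set_integrable_Cauchy_kernel:
  fixes g :: "real \<Rightarrow> 'a::{real_normed_field,banach,second_countable_topology}"
  assumes "set_integrable lborel {0..<1} g" "norm w < 1"
  shows "set_integrable lborel {0..<1} (\<lambda>t. g t / (1 - of_real t * w) ^ k)"
proof -
  have "set_integrable lborel {0..<1} (\<lambda>t. g t * inverse ((1 - of_real t * w) ^ k))"
    using Cauchy_kernel_neq_0[OF _ _ assms(2)]
    by (intro set_integrable_mult_continuous assms(1) continuous_intros) auto
  then show ?thesis by (simp add: divide_inverse)
qed

text \<open>Differentiation under the integral sign by dominated convergence: for \<open>w\<close> in a disc of radius \<open>\<rho> < 1\<close>
the kernel is Lipschitz in \<open>w\<close>, uniformly in \<open>t\<close>.  The complex case \<open>k = 1\<close> differentiates the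
Hilbert operator, the real case \<open>k = 2\<close> differentiates \<open>D_fun\<close>.\<close>
lemma has_field_derivative_Cauchy_integral:
  fixes g :: "real \<Rightarrow> 'a::{real_normed_field,banach,second_countable_topology}"
  assumes g: "set_integrable lborel {0..<1} g" and z: "norm z < 1"
  shows "((\<lambda>w. LINT t:{0..<1}|lborel. g t / (1 - of_real t * w) ^ k) has_field_derivative
    (LINT t:{0..<1}|lborel. of_nat k * of_real t * g t / (1 - of_real t * z) ^ Suc k)) (at z)"
proof -
  define \<rho> where "\<rho> = (1 + norm z) / 2"
  have \<rho>: "norm z < \<rho>" "\<rho> < 1" using z by (auto simp: \<rho>_def)
  let ?q = "\<lambda>w t. 1 / (1 - of_real t * w) ^ k"
  let ?q' = "\<lambda>w t. of_nat k * of_real t / (1 - of_real t * w) ^ Suc k"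
  have ball: "norm w < 1" if "w \<in> ball 0 \<rho>" for w :: 'a using that \<rho> by auto
  have kernel_deriv: "((\<lambda>w. ?q w t) has_field_derivative ?q' w t) (at w within S)"
    if "t \<in> {0..<1}" "norm w < 1" for t and w :: 'a and S
  proof -
    have "((\<lambda>w. inverse (1 - of_real t * w)) has_field_derivative
        of_real t * inverse (1 - of_real t * w) ^ 2) (at w within S)"
      using Cauchy_kernel_neq_0[of t w] that
      by (auto intro!: derivative_eq_intros simp: power2_eq_square)
    from DERIV_power[OF this, of k]
    have "((\<lambda>w. inverse (1 - of_real t * w) ^ k) has_field_derivative
        of_nat k * of_real t * inverse (1 - of_real t * w) ^ Suc k) (at w within S)"
      by (cases k) (simp_all add: power2_eq_square mult_ac)
    then show ?thesis by (simp add: divide_inverse power_inverse)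
  qed
  define B where "B = of_nat k / (1 - \<rho>) ^ Suc k"
  have bound: "norm (?q' w t) \<le> B" if t: "t \<in> {0..<1}" and w: "w \<in> ball 0 \<rho>" for t and w :: 'a
  proof -
    have "(1 - \<rho>) ^ Suc k \<le> norm (1 - of_real t * w) ^ Suc k"
      by (intro power_mono one_minus_norm_le_norm_one_minus) (use t w \<rho> in auto)
    moreover have "of_nat k * t \<le> real k" using t by (intro mult_right_le_one_le) auto
    ultimately show ?thesis
      using t \<rho> unfolding B_def norm_divide norm_mult norm_power
      by (intro frac_le) (auto simp: norm_mult)
  qed
  have "((\<lambda>w. LINT t:{0..<1}|lborel. g t * ((?q w t - ?q z t) / (w - z))) \<longlongrightarrow>
      (LINT t:{0..<1}|lborel. g t * ?q' z t)) (at z within ball 0 \<rho>)"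
  proof (rule set_integral_dominated_convergence_within)
    show "set_integrable lborel {0..<1} (\<lambda>t. g t * ((?q w t - ?q z t) / (w - z)))"
      if "w \<in> ball 0 \<rho>" "w \<noteq> z" for w
      using Cauchy_kernel_neq_0[OF _ _ ball[OF that(1)]] Cauchy_kernel_neq_0[OF _ _ z] that
      by (intro set_integrable_mult_continuous g continuous_intros) auto
    have "set_integrable lborel {0..<1} (\<lambda>t. g t * ?q' z t)"
      using Cauchy_kernel_neq_0[OF _ _ z]
      by (intro set_integrable_mult_continuous g continuous_intros) auto
    then show "set_borel_measurable lborel {0..<1} (\<lambda>t. g t * ?q' z t)"
      by (simp add: set_integrable_def set_borel_measurable_def)
    show "set_integrable lborel {0..<1} (\<lambda>t. norm (g t) * B)"
      using set_integrable_norm[OF g] by simp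
    show "((\<lambda>w. g t * ((?q w t - ?q z t) / (w - z))) \<longlongrightarrow> g t * ?q' z t) (at z within ball 0 \<rho>)"
      if "t \<in> {0..<1}" for t
      using kernel_deriv[OF that z] by (intro tendsto_mult tendsto_const) (simp add: has_field_derivative_iff)
    show "norm (g t * ((?q w t - ?q z t) / (w - z))) \<le> norm (g t) * B"
      if w: "w \<in> ball 0 \<rho>" "w \<noteq> z" and t: "t \<in> {0..<1}" for w t
    proof -
      have "norm (?q w t - ?q z t) \<le> B * norm (w - z)"
      proof (rule field_differentiable_bound[of "ball 0 \<rho>"])
        show "((\<lambda>w. ?q w t) has_field_derivative ?q' u t) (at u within ball 0 \<rho>)"
          if "u \<in> ball 0 \<rho>" for u :: 'a
          using kernel_deriv[OF t ball[OF that]] .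
      qed (use w \<rho> bound[OF t] in auto)
      then have "norm ((?q w t - ?q z t) / (w - z)) \<le> B"
        using w by (simp add: norm_divide divide_le_eq)
      from mult_left_mono[OF this norm_ge_zero[of "g t"]]
      show ?thesis by (simp add: norm_mult norm_divide)
    qed
  qed
  then have lim: "((\<lambda>w. LINT t:{0..<1}|lborel. g t * ((?q w t - ?q z t) / (w - z))) \<longlongrightarrow>
      (LINT t:{0..<1}|lborel. g t * ?q' z t)) (at z)"
    using at_within_open[of z "ball 0 \<rho>"] \<rho> by simp
  have quotient: "(LINT t:{0..<1}|lborel. g t * ((?q w t - ?q z t) / (w - z))) =
      ((LINT t:{0..<1}|lborel. g t / (1 - of_real t * w) ^ k) -
       (LINT t:{0..<1}|lborel. g t / (1 - of_real t * z) ^ k)) / (w - z)"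
    if "w \<in> ball 0 \<rho>" for w
  proof -
    have "(\<lambda>t. g t * ((?q w t - ?q z t) / (w - z))) =
        (\<lambda>t. (g t / (1 - of_real t * w) ^ k - g t / (1 - of_real t * z) ^ k) / (w - z))"
      by (simp add: right_diff_distrib)
    then show ?thesis
      using set_integral_diff(2)[OF set_integrable_Cauchy_kernel[OF g ball[OF that], of k]
        set_integrable_Cauchy_kernel[OF g z, of k]]
      by (simp only: set_integral_divide_zero)
  qed
  have "((\<lambda>w. ((LINT t:{0..<1}|lborel. g t / (1 - of_real t * w) ^ k) -
       (LINT t:{0..<1}|lborel. g t / (1 - of_real t * z) ^ k)) / (w - z)) \<longlongrightarrow>
      (LINT t:{0..<1}|lborel. g t * ?q' z t)) (at z)"
    by (rule Lim_transform_within_open[OF lim, of "ball 0 \<rho>"]) (use \<rho> quotient in auto)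
  then show ?thesis unfolding has_field_derivative_iff by (simp add: mult_ac)
qed

section \<open>The growth function and its defect\<close>
lemma one_minus_sq_pos: "0 \<le> t \<Longrightarrow> t < 1 \<Longrightarrow> 0 < 1 - t\<^sup>2" for t :: real
  by (simp add: power_less_one_iff abs_square_less_1)

lemma powr_one_minus: "x powr (1 - a) = x * x powr (- a)" if "0 \<le> x" for x a :: real
  using that by (simp add: powr_diff powr_minus divide_inverse)

lemma eventually_at_left_1: "\<forall>\<^sub>F t in at_left (1::real). 0 \<le> t \<and> t < 1"
proof -
  have "\<forall>\<^sub>F t in at_left (1::real). t \<in> {0<..<1}" by (rule eventually_at_left_real) simp
  then show ?thesis by eventually_elim auto
qed

lemma P_fun_0: "P_fun \<alpha> 0 = 0"
proof -
  have "AE s in lborel. indicator {0..0::real} s *\<^sub>R (1 - s\<^sup>2) powr - \<alpha> = 0"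
    using AE_lborel_singleton[of "0::real"] by eventually_elim (simp add: indicator_def)
  then show ?thesis unfolding P_fun_def set_lebesgue_integral_def
    by (rule integral_eq_zero_AE)
qed

lemma continuous_P_integrand: "continuous_on {0..<1::real} (\<lambda>s. (1 - s\<^sup>2) powr a)"
  by (intro continuous_intros) (use one_minus_sq_pos in fastforce)

lemma P_fun_deriv_within:
  assumes t: "t \<in> {0..<1}"
  shows "(P_fun \<alpha> has_real_derivative (1 - t\<^sup>2) powr (- \<alpha>)) (at t within {0..<1})"
proof -
  let ?p = "\<lambda>s::real. (1 - s\<^sup>2) powr (- \<alpha>)"
  define c where "c = (1 + t) / 2"
  have c: "t < c" "c < 1" using t by (auto simp: c_def)
  have cont: "continuous_on {0..x} ?p" if "x < 1" for x
    by (rule continuous_on_subset[OF continuous_P_integrand]) (use that in auto)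
  have eq: "P_fun \<alpha> x = integral {0..x} ?p" if "x < 1" for x
    unfolding P_fun_def
    by (rule set_borel_integral_eq_integral(2)[OF borel_integrable_atLeastAtMost'[OF cont[OF that]]])
  have "((\<lambda>x. integral {0..x} ?p) has_real_derivative ?p t) (at t within {0..c})"
    by (rule integral_has_real_derivative[OF cont]) (use c t in auto)
  then have "(P_fun \<alpha> has_real_derivative ?p t) (at t within {0..c})"
    by (rule has_field_derivative_transform_within[of _ _ _ _ 1]) (use t c in \<open>auto simp: eq\<close>)
  moreover have "at t within {0..c} = at t within {0..<1}"
    by (rule at_within_nhd[of _ "{..<c}"]) (use c in auto)
  ultimately show ?thesis by simp
qed

lemma P_fun_deriv:
  assumes "0 < t" "t < 1"
  shows "(P_fun \<alpha> has_real_derivative (1 - t\<^sup>2) powr (- \<alpha>)) (at t)"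
proof -
  have "at t within {0..<1} = at t"
    by (rule at_within_interior) (use assms in auto)
  then show ?thesis using P_fun_deriv_within[of t \<alpha>] assms by simp
qed

lemma continuous_on_P_fun: "continuous_on {0..<1} (P_fun \<alpha>)"
  using P_fun_deriv_within by (rule DERIV_continuous_on)

lemma P_fun_nonneg:
  assumes "0 \<le> t" shows "0 \<le> P_fun \<alpha> t"
  unfolding P_fun_def set_lebesgue_integral_def by (intro integral_nonneg_AE) auto

lemma P_fun_ge:
  assumes "0 \<le> \<alpha>" "0 \<le> t" "t < 1" shows "t \<le> P_fun \<alpha> t"
proof -
  have "P_fun \<alpha> 0 - 0 \<le> P_fun \<alpha> t - t"
  proof (rule DERIV_nonneg_imp_increasing_open[OF assms(2)])
    show "continuous_on {0..t} (\<lambda>t. P_fun \<alpha> t - t)"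
      by (intro continuous_intros continuous_on_subset[OF continuous_on_P_fun]) (use assms in auto)
    show "\<exists>y. ((\<lambda>t. P_fun \<alpha> t - t) has_real_derivative y) (at x) \<and> 0 \<le> y" if "0 < x" "x < t" for x
    proof (intro exI conjI)
      show "((\<lambda>t. P_fun \<alpha> t - t) has_real_derivative (1 - x\<^sup>2) powr (- \<alpha>) - 1) (at x)"
        using assms that by (auto intro!: derivative_eq_intros P_fun_deriv)
      have "1 powr (- \<alpha>) \<le> (1 - x\<^sup>2) powr (- \<alpha>)"
        using one_minus_sq_pos[of x] assms that by (intro powr_mono2') auto
      then show "0 \<le> (1 - x\<^sup>2) powr (- \<alpha>) - 1" by simp
    qed
  qed
  then show ?thesis by (simp add: P_fun_0)
qed

text \<open>The first term is the antiderivative of \<open>t * (1 - t\<^sup>2) powr (- \<alpha>)\<close>; it carries the whole singularity of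
\<open>t * P_fun \<alpha> t\<close> at 1, so the difference stays bounded.\<close>
definition P_defect :: "real \<Rightarrow> real \<Rightarrow> real" where
  "P_defect \<alpha> t = (1 - t\<^sup>2) powr (1 - \<alpha>) / (2 * (\<alpha> - 1)) - t * P_fun \<alpha> t"

definition sq_powr_integral :: "real \<Rightarrow> real" where
  "sq_powr_integral \<alpha> = (LINT t:{0..<1}|lborel. (1 - t\<^sup>2) powr (1 - \<alpha>))"

text \<open>The limit of \<open>P_defect \<alpha>\<close> at 1, in a form that shows its sign.\<close>
definition P_defect_end :: "real \<Rightarrow> real" where "P_defect_end \<alpha> = (3 - 2 * \<alpha>) * sq_powr_integral \<alpha> / (2 * (\<alpha> - 1))"

context
  fixes \<alpha> :: real
  assumes \<alpha>1: "1 < \<alpha>" and \<alpha>2: "\<alpha> < 2"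
begin

text \<open>From \<open>1 - t \<le> 1 - t\<^sup>2\<close>, since the right-hand side is an antiderivative of \<open>(1 - t) powr (- \<alpha>)\<close>.\<close>
lemma P_fun_le:
  assumes t: "0 \<le> t" "t < 1"
  shows "P_fun \<alpha> t \<le> (1 - t) powr (1 - \<alpha>) / (\<alpha> - 1)"
proof -
  let ?G = "\<lambda>t. (1 - t) powr (1 - \<alpha>) / (\<alpha> - 1) - P_fun \<alpha> t"
  have "?G 0 \<le> ?G t"
  proof (rule DERIV_nonneg_imp_increasing_open[OF t(1)])
    show "continuous_on {0..t} ?G"
      by (intro continuous_intros continuous_on_subset[OF continuous_on_P_fun]) (use t \<alpha>1 in auto)
    fix x assume x: "0 < x" "x < t"
    have "(1 - x\<^sup>2) powr (- \<alpha>) \<le> (1 - x) powr (- \<alpha>)"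
    proof (rule powr_mono2')
      show "1 - x \<le> 1 - x\<^sup>2" using x t by (simp add: power2_eq_square mult_left_le_one_le)
    qed (use x t \<alpha>1 in auto)
    moreover have "(?G has_real_derivative (1 - x) powr (- \<alpha>) - (1 - x\<^sup>2) powr (- \<alpha>)) (at x)"
    proof (intro DERIV_diff P_fun_deriv)
      have "((\<lambda>t. (1 - t) powr (1 - \<alpha>)) has_real_derivative (\<alpha> - 1) * (1 - x) powr (- \<alpha>)) (at x)"
        using x t by (auto intro!: derivative_eq_intros simp: algebra_simps)
      from DERIV_cdivide[OF this, of "\<alpha> - 1"]
      show "((\<lambda>t. (1 - t) powr (1 - \<alpha>) / (\<alpha> - 1)) has_real_derivative (1 - x) powr (- \<alpha>)) (at x)"
        using \<alpha>1 by simp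
    qed (use x t in auto)
    ultimately show "\<exists>y. (?G has_real_derivative y) (at x) \<and> 0 \<le> y" by (meson diff_ge_0_iff_ge)
  qed
  moreover have "0 \<le> ?G 0" using \<alpha>1 by (simp add: P_fun_0)
  ultimately show ?thesis by simp
qed

lemma set_integrable_P_fun: "set_integrable lborel {0..<1} (P_fun \<alpha>)"
proof (rule set_integrable_continuous_bound[OF continuous_on_P_fun])
  show "set_integrable lborel {0..<1} (\<lambda>t. (1 - t) powr (- (\<alpha> - 1)) / (\<alpha> - 1))"
    using integrable_one_minus_powr[of "\<alpha> - 1"] \<alpha>2 by simp
  show "norm (P_fun \<alpha> t) \<le> (1 - t) powr (- (\<alpha> - 1)) / (\<alpha> - 1)" if "t \<in> {0..<1}" for t
    using P_fun_le[of t] P_fun_nonneg[of t \<alpha>] that by auto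
qed

lemma P_fun_times_vanishing: "((\<lambda>t. (1 - t) * P_fun \<alpha> t) \<longlongrightarrow> 0) (at_left 1)"
proof (rule tendsto_sandwich)
  have ev: "\<forall>\<^sub>F t in at_left (1::real). 0 \<le> t \<and> t < 1"
    by (rule eventually_at_left_1)
  show "\<forall>\<^sub>F t in at_left 1. 0 \<le> (1 - t) * P_fun \<alpha> t"
    using ev by eventually_elim (auto simp: P_fun_nonneg)
  show "\<forall>\<^sub>F t in at_left 1. (1 - t) * P_fun \<alpha> t \<le> (1 - t) powr (2 - \<alpha>) / (\<alpha> - 1)"
    using ev
  proof eventually_elim
    case (elim t)
    then have "(1 - t) * P_fun \<alpha> t \<le> (1 - t) * ((1 - t) powr (1 - \<alpha>) / (\<alpha> - 1))"
      by (intro mult_left_mono P_fun_le) auto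
    also have "\<dots> = (1 - t) powr (2 - \<alpha>) / (\<alpha> - 1)"
      using powr_one_minus[of "1 - t" "\<alpha> - 1"] elim by simp
    finally show ?case .
  qed
  have "((\<lambda>t. (1 - t) powr (2 - \<alpha>) / (\<alpha> - 1)) \<longlongrightarrow> (1 - 1) powr (2 - \<alpha>) / (\<alpha> - 1)) (at_left (1::real))"
    by (intro tendsto_intros tendsto_powr'; use \<alpha>1 \<alpha>2 in \<open>auto simp: eventually_at_filter\<close>)
  then show "((\<lambda>t. (1 - t) powr (2 - \<alpha>) / (\<alpha> - 1)) \<longlongrightarrow> 0) (at_left (1::real))" by simp
qed auto

lemma one_minus_sq_powr_le:
  assumes "0 \<le> t" "t < 1"
  shows "(1 - t\<^sup>2) powr (1 - \<alpha>) \<le> (1 - t) powr (1 - \<alpha>)"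
proof (rule powr_mono2')
  show "1 - t \<le> 1 - t\<^sup>2" using assms by (simp add: power2_eq_square mult_left_le_one_le)
qed (use assms \<alpha>1 in auto)

lemma set_integrable_one_minus_sq_powr:
  "set_integrable lborel {0..<1} (\<lambda>t. (1 - t\<^sup>2) powr (1 - \<alpha>))"
proof (rule set_integrable_continuous_bound[OF continuous_P_integrand])
  show "set_integrable lborel {0..<1} (\<lambda>t. (1 - t) powr (- (\<alpha> - 1)))"
    using integrable_one_minus_powr[of "\<alpha> - 1"] \<alpha>2 by simp
qed (use one_minus_sq_powr_le in auto)

lemma set_integrable_C_const:
  "set_integrable lborel {0..<1} (\<lambda>t. (1 - t) * (1 - t\<^sup>2) powr (- \<alpha>))"
proof (rule set_integrable_continuous_bound)
  show "continuous_on {0..<1} (\<lambda>t::real. (1 - t) * (1 - t\<^sup>2) powr (- \<alpha>))"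
    by (intro continuous_intros continuous_P_integrand)
  show "set_integrable lborel {0..<1} (\<lambda>t. (1 - t\<^sup>2) powr (1 - \<alpha>))"
    by (rule set_integrable_one_minus_sq_powr)
  show "norm ((1 - t) * (1 - t\<^sup>2) powr (- \<alpha>)) \<le> (1 - t\<^sup>2) powr (1 - \<alpha>)" if "t \<in> {0..<1}" for t :: real
  proof -
    have "1 - t \<le> 1 - t\<^sup>2" using that by (simp add: power2_eq_square mult_left_le_one_le)
    moreover have "0 \<le> 1 - t\<^sup>2" using that one_minus_sq_pos[of t] by auto
    ultimately show ?thesis using that by (auto simp: powr_one_minus abs_mult intro!: mult_right_mono)
  qed
qed

text \<open>Integration by parts with the antiderivative \<open>(1 - t) * P_fun \<alpha> t\<close>, which vanishes at both ends.\<close>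
lemma C_const_eq_integral_P_fun: "C_const \<alpha> = (LINT t:{0..<1}|lborel. P_fun \<alpha> t)"
proof -
  have "(LINT t:{0..<1}|lborel. (1 - t) * (1 - t\<^sup>2) powr (- \<alpha>) - P_fun \<alpha> t) = 0 - (1 - 0) * P_fun \<alpha> 0"
  proof (rule FTC_half_open[OF _ _ _ P_fun_times_vanishing])
    show "continuous_on {0..<1} (\<lambda>t. (1 - t) * P_fun \<alpha> t)"
      by (intro continuous_intros continuous_on_P_fun)
    show "((\<lambda>t. (1 - t) * P_fun \<alpha> t) has_real_derivative (1 - t) * (1 - t\<^sup>2) powr (- \<alpha>) - P_fun \<alpha> t) (at t)"
      if "0 < t" "t < 1" for t
      using that by (auto intro!: derivative_eq_intros P_fun_deriv)
  qed (intro set_integral_diff set_integrable_C_const set_integrable_P_fun)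
  then show ?thesis
    using set_integral_diff(2)[OF set_integrable_C_const set_integrable_P_fun]
    by (simp add: P_fun_0 C_const_def)
qed

text \<open>The substitution \<open>v = t\<^sup>2\<close>.\<close>
lemma sq_powr_integral_eq_Beta: "sq_powr_integral \<alpha> = Beta (1 / 2) (2 - \<alpha>) / 2"
proof -
  let ?f = "\<lambda>v::real. v powr (1 / 2 - 1) * (1 - v) powr (2 - \<alpha> - 1)"
  have f: "set_integrable lborel {0..1} ?f" and fB: "(LINT v:{0..1}|lborel. ?f v) = Beta (1 / 2) (2 - \<alpha>)"
    using set_integral_Beta[of "1/2" "2 - \<alpha>"] \<alpha>2 by auto
  note sub = integral_substitution[of "\<lambda>t::real. t\<^sup>2" 0 1 ?f "\<lambda>t. 2 * t"]
  (* At t = 0 the left-hand side is 0, because 0 powr a = 0; hence the passage almost everywhere. *)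
  have eq: "?f (t\<^sup>2) * (2 * t) = 2 * (1 - t\<^sup>2) powr (1 - \<alpha>)" if "0 < t" for t :: real
    using that by (simp add: powr_minus powr_half_sqrt field_simps)
  have int: "set_integrable lborel {0..1} (\<lambda>t. ?f (t\<^sup>2) * (2 * t))"
    by (rule sub(1)) (use f in \<open>auto intro!: derivative_eq_intros continuous_intros\<close>)
  have "(LBINT v. ?f v * indicator {0\<^sup>2..1\<^sup>2} v) = (LBINT t. ?f (t\<^sup>2) * (2 * t) * indicator {0..1} t)"
    by (rule sub(2)) (use f in \<open>auto intro!: derivative_eq_intros continuous_intros\<close>)
  then have "Beta (1 / 2) (2 - \<alpha>) = (LINT t:{0..1}|lborel. ?f (t\<^sup>2) * (2 * t))"
    unfolding fB[symmetric] set_lebesgue_integral_def by (simp add: mult_ac)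
  also have "\<dots> = (LINT t:{0..<1}|lborel. ?f (t\<^sup>2) * (2 * t))"
    by (rule set_integral_half_open_eq_closed[OF int, symmetric])
  also have "\<dots> = (LINT t:{0..<1}|lborel. 2 * (1 - t\<^sup>2) powr (1 - \<alpha>))"
  proof (rule set_lebesgue_integral_cong_AE)
    show "AE t\<in>{0..<1} in lborel. ?f (t\<^sup>2) * (2 * t) = 2 * (1 - t\<^sup>2) powr (1 - \<alpha>)"
      using AE_lborel_singleton[of "0::real"] by eventually_elim (use eq in auto)
  qed auto
  also have "\<dots> = 2 * sq_powr_integral \<alpha>" by (simp add: sq_powr_integral_def)
  finally show ?thesis by simp
qed

lemma sq_powr_integral_pos: "0 < sq_powr_integral \<alpha>"
  using \<alpha>2 unfolding sq_powr_integral_eq_Beta Beta_def by (auto intro!: divide_pos_pos mult_pos_pos Gamma_real_pos)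

text \<open>The integrand of \<open>C_const\<close> is a difference of two nonintegrable functions.  Differentiating
\<open>(t - 1) * (1 - t\<^sup>2) powr (1 - \<alpha>)\<close>, which goes from \<open>- 1\<close> to \<open>0\<close>, relates it to an integrand with the
exponent raised by one.\<close>
lemma C_const_eq_sq_powr_integral: "2 * (\<alpha> - 1) * C_const \<alpha> = 1 - (3 - 2 * \<alpha>) * sq_powr_integral \<alpha>"
proof -
  let ?G = "\<lambda>t::real. (t - 1) * (1 - t\<^sup>2) powr (1 - \<alpha>)"
  let ?g1 = "\<lambda>t::real. (1 - t) * (1 - t\<^sup>2) powr (- \<alpha>)"
  let ?g2 = "\<lambda>t::real. (1 - t\<^sup>2) powr (1 - \<alpha>)"
  have lim: "(?G \<longlongrightarrow> 0) (at_left 1)"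
  proof (rule Lim_null_comparison)
    have "\<forall>\<^sub>F t in at_left (1::real). 0 \<le> t \<and> t < 1"
      by (rule eventually_at_left_1)
    then show "\<forall>\<^sub>F t in at_left 1. norm (?G t) \<le> (1 - t) powr (2 - \<alpha>)"
    proof eventually_elim
      case (elim t)
      then have "norm (?G t) \<le> (1 - t) * (1 - t) powr (1 - \<alpha>)"
        using one_minus_sq_powr_le[of t] by (auto simp: abs_mult intro!: mult_left_mono)
      then show ?case using powr_one_minus[of "1 - t" "\<alpha> - 1"] elim by simp
    qed
    have "((\<lambda>t. (1 - t) powr (2 - \<alpha>)) \<longlongrightarrow> (1 - 1) powr (2 - \<alpha>)) (at_left (1::real))"
      by (intro tendsto_intros tendsto_powr'; use \<alpha>1 \<alpha>2 in \<open>auto simp: eventually_at_filter\<close>)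
    then show "((\<lambda>t. (1 - t) powr (2 - \<alpha>)) \<longlongrightarrow> 0) (at_left (1::real))" by simp
  qed
  have "(LINT t:{0..<1}|lborel. 2 * (\<alpha> - 1) * ?g1 t + (3 - 2 * \<alpha>) * ?g2 t) = 0 - ?G 0"
  proof (rule FTC_half_open[OF _ _ _ lim])
    show "continuous_on {0..<1} ?G" by (intro continuous_intros continuous_P_integrand)
    show "(?G has_real_derivative 2 * (\<alpha> - 1) * ?g1 t + (3 - 2 * \<alpha>) * ?g2 t) (at t)"
      if t: "0 < t" "t < 1" for t
    proof -
      have pos: "0 < 1 - t\<^sup>2" using one_minus_sq_pos[of t] t by simp
      then have "(?G has_real_derivative
          (1 - t\<^sup>2) powr (1 - \<alpha>) + (t - 1) * ((1 - \<alpha>) * (1 - t\<^sup>2) powr (- \<alpha>) * (- 2 * t))) (at t)"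
        by (auto intro!: derivative_eq_intros)
      also have "(1 - t\<^sup>2) powr (1 - \<alpha>) + (t - 1) * ((1 - \<alpha>) * (1 - t\<^sup>2) powr (- \<alpha>) * (- 2 * t)) =
          2 * (\<alpha> - 1) * ?g1 t + (3 - 2 * \<alpha>) * ?g2 t"
        using pos by (simp add: powr_one_minus) (simp add: algebra_simps power2_eq_square)
      finally show ?thesis .
    qed
  qed (intro set_integral_add set_integrable_mult_right set_integrable_C_const set_integrable_one_minus_sq_powr)
  also have "(LINT t:{0..<1}|lborel. 2 * (\<alpha> - 1) * ?g1 t + (3 - 2 * \<alpha>) * ?g2 t) =
      2 * (\<alpha> - 1) * C_const \<alpha> + (3 - 2 * \<alpha>) * sq_powr_integral \<alpha>"
    unfolding C_const_def sq_powr_integral_def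
    by (subst set_integral_add(2))
      (intro set_integrable_mult_right set_integrable_C_const set_integrable_one_minus_sq_powr | simp)+
  finally show ?thesis by simp
qed

text \<open>The shift \<open>\<Gamma>(x + 1) = x * \<Gamma>(x)\<close> in numerator and denominator removes the factor \<open>3 - 2 * \<alpha>\<close>, except at
\<open>\<alpha> = 3/2\<close>, where both sides equal 1.\<close>
lemma C_const_eq_gamma_quotient:
  "C_const \<alpha> = 1 / (2 * (\<alpha> - 1)) + sqrt pi / 2 * gamma_quotient \<alpha>"
proof (cases "\<alpha> = 3 / 2")
  case True
  have "gamma_quotient \<alpha> = 0"
    unfolding gamma_quotient_def using tendsto_Lim[OF _ gamma_quotient_tendsto] True by simp
  then show ?thesis using C_const_eq_sq_powr_integral unfolding True by simp
next
  case False
  have nonint: "x \<notin> \<int>\<^sub>\<le>\<^sub>0" if "-1 < x" "x \<noteq> 0" for x :: real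
  proof
    assume "x \<in> \<int>\<^sub>\<le>\<^sub>0"
    then obtain n :: int where "x = of_int n" "n \<le> 0" by (auto elim!: nonpos_Ints_cases)
    then show False using that by auto
  qed
  have G1: "Gamma (2 - \<alpha>) = (1 - \<alpha>) * Gamma (1 - \<alpha>)"
    using Gamma_plus1[of "1 - \<alpha>"] nonint[of "1 - \<alpha>"] \<alpha>1 \<alpha>2 by (simp add: add.commute)
  have G2: "Gamma (1/2 + (2 - \<alpha>)) = (3 / 2 - \<alpha>) * Gamma (3 / 2 - \<alpha>)"
    using Gamma_plus1[of "3 / 2 - \<alpha>"] nonint[of "3 / 2 - \<alpha>"] \<alpha>1 \<alpha>2 False
    by (simp add: algebra_simps)
  have "Gamma (3 / 2 - \<alpha>) \<noteq> 0"
    using nonint[of "3 / 2 - \<alpha>"] \<alpha>1 \<alpha>2 False by (simp add: Gamma_eq_zero_iff)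
  then have "(3 - 2 * \<alpha>) * sq_powr_integral \<alpha> = sqrt pi * (1 - \<alpha>) * (Gamma (1 - \<alpha>) / Gamma (3 / 2 - \<alpha>))"
    unfolding sq_powr_integral_eq_Beta Beta_def G1 G2 Gamma_one_half_real
    using False by (simp add: divide_simps)
  then have "(3 - 2 * \<alpha>) * sq_powr_integral \<alpha> = sqrt pi * (1 - \<alpha>) * gamma_quotient \<alpha>"
    using False by (simp add: gamma_quotient_def)
  then have "2 * (\<alpha> - 1) * C_const \<alpha> = 1 + (\<alpha> - 1) * (sqrt pi * gamma_quotient \<alpha>)"
    using C_const_eq_sq_powr_integral by (simp add: algebra_simps)
  then show ?thesis using \<alpha>1 by (simp add: field_simps)
qed

lemma P_defect_0: "P_defect \<alpha> 0 = 1 / (2 * (\<alpha> - 1))"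
  by (simp add: P_defect_def)

lemma P_defect_deriv:
  assumes "0 < t" "t < 1"
  shows "(P_defect \<alpha> has_real_derivative - P_fun \<alpha> t) (at t)"
proof -
  have pos: "0 < 1 - t\<^sup>2" using one_minus_sq_pos[of t] assms by simp
  then have "((\<lambda>t. (1 - t\<^sup>2) powr (1 - \<alpha>)) has_real_derivative
      (t * (1 - t\<^sup>2) powr (- \<alpha>)) * (2 * (\<alpha> - 1))) (at t)"
    by (auto intro!: derivative_eq_intros simp: algebra_simps)
  from DERIV_cdivide[OF this, of "2 * (\<alpha> - 1)"]
  have "((\<lambda>t. (1 - t\<^sup>2) powr (1 - \<alpha>) / (2 * (\<alpha> - 1))) has_real_derivative
      t * (1 - t\<^sup>2) powr (- \<alpha>)) (at t)"
    using \<alpha>1 by simp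
  from DERIV_diff[OF this DERIV_mult[OF DERIV_ident P_fun_deriv[OF assms, of \<alpha>]]]
  show ?thesis unfolding P_defect_def by (simp add: mult.commute)
qed

lemma continuous_on_P_defect: "continuous_on {0..<1} (P_defect \<alpha>)"
  unfolding P_defect_def using \<alpha>1 by (intro continuous_intros continuous_P_integrand continuous_on_P_fun) auto

lemma P_defect_tendsto: "(P_defect \<alpha> \<longlongrightarrow> P_defect_end \<alpha>) (at_left 1)"
proof -
  have "(P_defect \<alpha> \<longlongrightarrow> P_defect \<alpha> 0 + (LINT t:{0..<1}|lborel. - P_fun \<alpha> t)) (at_left 1)"
    by (rule FTC_tendsto_at_left[OF continuous_on_P_defect P_defect_deriv])
      (use set_integrable_P_fun set_integrable_mult_right[of "-1" lborel "{0..<1}" "P_fun \<alpha>"] in auto)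
  also have "P_defect \<alpha> 0 + (LINT t:{0..<1}|lborel. - P_fun \<alpha> t) = 1 / (2 * (\<alpha> - 1)) - C_const \<alpha>"
    using set_integral_uminus[OF set_integrable_P_fun] by (simp add: P_defect_0 C_const_eq_integral_P_fun)
  also have "\<dots> = P_defect_end \<alpha>"
    using C_const_eq_sq_powr_integral \<alpha>1 by (simp add: P_defect_end_def field_simps)
  finally show ?thesis .
qed

lemma P_defect_antimono:
  assumes "0 \<le> s" "s \<le> t" "t < 1" shows "P_defect \<alpha> t \<le> P_defect \<alpha> s"
proof (rule DERIV_nonpos_imp_decreasing_open[OF assms(2)])
  show "continuous_on {s..t} (P_defect \<alpha>)"
    by (rule continuous_on_subset[OF continuous_on_P_defect]) (use assms in auto)
  show "\<exists>y. (P_defect \<alpha> has_real_derivative y) (at x) \<and> y \<le> 0" if "s < x" "x < t" for x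
    using P_defect_deriv[of x] P_fun_nonneg[of x \<alpha>] assms that by (intro exI[of _ "- P_fun \<alpha> x"]) auto
qed

lemma P_defect_end_le:
  assumes "0 \<le> t" "t < 1" shows "P_defect_end \<alpha> \<le> P_defect \<alpha> t"
proof (rule tendsto_upperbound[OF P_defect_tendsto])
  have "\<forall>\<^sub>F x in at_left 1. x \<in> {t<..<1}" using eventually_at_left_real assms by blast
  then show "\<forall>\<^sub>F x in at_left 1. P_defect \<alpha> x \<le> P_defect \<alpha> t"
    by eventually_elim (use P_defect_antimono assms in auto)
qed auto

end

section \<open>The derivative of D\<close>
lemma D_fun_deriv_raw:
  fixes \<alpha> r :: real
  assumes P: "set_integrable lborel {0..<1} (P_fun \<alpha>)" and r: "\<bar>r\<bar> < 1"
  shows "(D_fun \<alpha> has_real_derivative (1 - r\<^sup>2) powr (\<alpha> - 1) *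
    ((1 - r\<^sup>2) * (LINT t:{0..<1}|lborel. 2 * t * (t * P_fun \<alpha> t) / (1 - r * t) ^ 3)
      - 2 * \<alpha> * r * (LINT t:{0..<1}|lborel. t * P_fun \<alpha> t / (1 - r * t)\<^sup>2))) (at r)"
proof -
  have Q: "set_integrable lborel {0..<1} (\<lambda>t. t * P_fun \<alpha> t)"
    using set_integrable_mult_continuous[OF P, of "\<lambda>t. t"] by (simp add: mult.commute)
  have S: "((\<lambda>r. LINT t:{0..<1}|lborel. t * P_fun \<alpha> t / (1 - r * t)\<^sup>2) has_real_derivative
      (LINT t:{0..<1}|lborel. 2 * t * (t * P_fun \<alpha> t) / (1 - r * t) ^ 3)) (at r)"
    using has_field_derivative_Cauchy_integral[OF Q, of r 2] r by (simp add: mult.commute[of r] mult.commute numeral_3_eq_3)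
  have "((\<lambda>r. (1 - r\<^sup>2) powr \<alpha>) has_real_derivative \<alpha> * (1 - r\<^sup>2) powr (\<alpha> - 1) * (- 2 * r)) (at r)"
    using r by (auto intro!: derivative_eq_intros simp: abs_square_less_1)
  from DERIV_mult[OF this S] have "((\<lambda>r. (1 - r\<^sup>2) powr \<alpha> * (LINT t:{0..<1}|lborel. t * P_fun \<alpha> t / (1 - r * t)\<^sup>2)) has_real_derivative
     \<alpha> * (1 - r\<^sup>2) powr (\<alpha> - 1) * (- 2 * r) * (LINT t:{0..<1}|lborel. t * P_fun \<alpha> t / (1 - r * t)\<^sup>2) +
     (LINT t:{0..<1}|lborel. 2 * t * (t * P_fun \<alpha> t) / (1 - r * t) ^ 3) * (1 - r\<^sup>2) powr \<alpha>) (at r)" .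
  moreover have "(1 - r\<^sup>2) powr \<alpha> = (1 - r\<^sup>2) * (1 - r\<^sup>2) powr (\<alpha> - 1)"
    using powr_one_minus[of "1 - r\<^sup>2" "1 - \<alpha>"] r by (simp add: abs_square_le_1)
  ultimately show ?thesis unfolding D_fun_def by (simp add: algebra_simps)
qed

lemma set_integrable_Cauchy_kernel_mult:
  fixes f \<phi> :: "real \<Rightarrow> real"
  assumes "set_integrable lborel {0..<1} f" "continuous_on {0..1} \<phi>" "\<bar>r\<bar> < 1"
  shows "set_integrable lborel {0..<1} (\<lambda>t. f t * \<phi> t / (1 - r * t) ^ k)"
  using set_integrable_Cauchy_kernel[OF set_integrable_mult_continuous[OF assms(1,2)], of r k] assms(3)
  by (simp add: mult.commute[of r])

lemma one_minus_mult_pos: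
  fixes r t :: real
  assumes "\<bar>r\<bar> < 1" "0 \<le> t" "t \<le> 1"
  shows "0 < 1 - r * t"
proof -
  have "r * t \<le> \<bar>r\<bar> * 1" using assms by (intro mult_mono) auto
  then show ?thesis using assms by simp
qed

text \<open>The factor \<open>(1 - r) / (1 - r * t)\<close> is at most 1 and tends to 0 for each \<open>t < 1\<close>, so dominated
convergence applies even though \<open>W r\<close> need not converge.\<close>
lemma Cauchy_integral_vanishing:
  fixes W :: "real \<Rightarrow> real \<Rightarrow> real"
  assumes W: "\<And>r. r \<in> {0..<1} \<Longrightarrow> set_integrable lborel {0..<1} (W r)"
    and w: "set_integrable lborel {0..<1} w"
    and bound: "\<And>r t. r \<in> {0..<1} \<Longrightarrow> t \<in> {0..<1} \<Longrightarrow> \<bar>W r t\<bar> \<le> w t"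
  shows "((\<lambda>r. (1 - r) * (LINT t:{0..<1}|lborel. W r t / (1 - r * t))) \<longlongrightarrow> 0) (at_left 1)"
proof -
  have frac: "0 \<le> (1 - r) / (1 - r * t)" "(1 - r) / (1 - r * t) \<le> 1" if "r \<in> {0..<1}" "t \<in> {0..<1}" for r t :: real
  proof -
    have "r * t \<le> r * 1" using that by (intro mult_left_mono) auto
    then show "0 \<le> (1 - r) / (1 - r * t)" "(1 - r) / (1 - r * t) \<le> 1" using that by auto
  qed
  have "((\<lambda>r. LINT t:{0..<1}|lborel. W r t * ((1 - r) / (1 - r * t))) \<longlongrightarrow> (LINT t:{0..<1::real}|lborel. 0))
      (at 1 within {0..<1})"
  proof (rule set_integral_dominated_convergence_within[where w = w])
    show "set_integrable lborel {0..<1} (\<lambda>t. W r t * ((1 - r) / (1 - r * t)))" if "r \<in> {0..<1}" for r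
      using set_integrable_mult_right[OF set_integrable_Cauchy_kernel_mult[OF W[OF that] continuous_on_const, of r 1 1], of "1 - r"] that
      by (simp add: mult_ac)
    show bd: "norm (W r t * ((1 - r) / (1 - r * t))) \<le> w t" if "r \<in> {0..<1}" "t \<in> {0..<1}" for r t
    proof -
      have "\<bar>W r t\<bar> * ((1 - r) / (1 - r * t)) \<le> w t * 1"
        using bound[OF that] frac[OF that] by (intro mult_mono) auto
      then show ?thesis using frac(1)[OF that] by (simp only: real_norm_def abs_mult abs_of_nonneg mult_1_right)
    qed
    show "((\<lambda>r. W r t * ((1 - r) / (1 - r * t))) \<longlongrightarrow> 0) (at 1 within {0..<1})" if t: "t \<in> {0..<1}" for t
    proof (rule Lim_null_comparison)
      have "norm (W r t * ((1 - r) / (1 - r * t))) \<le> w t * ((1 - r) / (1 - r * t))" if "r \<in> {0..<1}" for r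
        using mult_right_mono[OF bound[OF that t] frac(1)[OF that t]] frac(1)[OF that t]
        by (simp only: real_norm_def abs_mult abs_of_nonneg)
      then show "\<forall>\<^sub>F r in at 1 within {0..<1}. norm (W r t * ((1 - r) / (1 - r * t))) \<le> w t * ((1 - r) / (1 - r * t))"
        by (auto simp: eventually_at_filter)
      have "((\<lambda>r. w t * ((1 - r) / (1 - r * t))) \<longlongrightarrow> w t * ((1 - 1) / (1 - 1 * t))) (at 1 within {0..<1})"
        by (intro tendsto_intros) (use t in auto)
      then show "((\<lambda>r. w t * ((1 - r) / (1 - r * t))) \<longlongrightarrow> 0) (at 1 within {0..<1})" by simp
    qed
    show "set_integrable lborel {0..<1} w" by (rule w)
  qed (simp_all add: set_borel_measurable_def)
  then show ?thesis
    by (simp add: tendsto_at_left_1_iff set_integral_mult_right[symmetric] mult_ac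
        del: set_integral_mult_right)
qed

text \<open>The derivative of \<open>D_fun \<alpha>\<close> at \<open>r\<close> without its positive factor \<open>(1 - r\<^sup>2) powr (\<alpha> - 1)\<close>, integrated by
parts so that the sign of the integrand can be read off.\<close>
definition D_slope :: "real \<Rightarrow> real \<Rightarrow> real" where
  "D_slope \<alpha> r = (LINT t:{0..<1}|lborel.
     (P_fun \<alpha> t * (1 - t\<^sup>2 + 2 * (\<alpha> - 1) * t * (t - r)) + 2 * (\<alpha> - 1) * t * P_defect \<alpha> t) / (1 - r * t)\<^sup>2)"

context
  fixes \<alpha> :: real
  assumes \<alpha>1: "1 < \<alpha>" and \<alpha>2: "\<alpha> < 2"
begin

lemma set_integrable_P_defect: "set_integrable lborel {0..<1} (P_defect \<alpha>)"
proof -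
  have "set_integrable lborel {0..<1} (\<lambda>t. (1 - t\<^sup>2) powr (1 - \<alpha>) / (2 * (\<alpha> - 1)) - P_fun \<alpha> t * t)"
    by (intro set_integral_diff set_integrable_divide set_integrable_one_minus_sq_powr[OF \<alpha>1 \<alpha>2] set_integrable_mult_continuous[OF set_integrable_P_fun[OF \<alpha>1 \<alpha>2]] continuous_intros)
  then show ?thesis unfolding P_defect_def[abs_def] by (simp add: mult.commute)
qed

lemma abs_P_defect_le:
  assumes "0 \<le> t" "t < 1" shows "\<bar>P_defect \<alpha> t\<bar> \<le> P_defect \<alpha> 0 + \<bar>P_defect_end \<alpha>\<bar>"
proof -
  have "0 \<le> P_defect \<alpha> 0" using \<alpha>1 by (simp add: P_defect_def)
  then show ?thesis
    using P_defect_end_le[OF \<alpha>1 \<alpha>2 assms] P_defect_antimono[OF \<alpha>1 \<alpha>2 order.refl assms] by linarith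
qed

text \<open>The kernel splits as \<open>2 * t * (1 - r\<^sup>2) - 2 * \<alpha> * r * (1 - r * t) = 2 * (t - r) - 2 * (\<alpha> - 1) * r * (1 - r * t)\<close>.
The first part, over \<open>(1 - r * t) ^ 3\<close>, is minus the derivative of \<open>(1 - t\<^sup>2) / (1 - r * t)\<^sup>2\<close>, so one
integration by parts moves it onto \<open>t * P_fun \<alpha> t\<close>.  Finally \<open>P_defect\<close> replaces the power
\<open>(1 - t\<^sup>2) powr (1 - \<alpha>)\<close> that this produces.\<close>
lemma D_slope_eq:
  assumes r: "\<bar>r\<bar> < 1"
  shows "(1 - r\<^sup>2) * (LINT t:{0..<1}|lborel. 2 * t * (t * P_fun \<alpha> t) / (1 - r * t) ^ 3)
      - 2 * \<alpha> * r * (LINT t:{0..<1}|lborel. t * P_fun \<alpha> t / (1 - r * t)\<^sup>2) = D_slope \<alpha> r"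
proof -
  let ?I = "\<lambda>f. LINT t:{0..<1}|lborel. f t"
  let ?P = "P_fun \<alpha>"
  note K = set_integrable_Cauchy_kernel_mult[OF _ _ r]
  let ?G = "\<lambda>t. t * ?P t * (1 - t\<^sup>2) / (1 - r * t)\<^sup>2"
  let ?a = "\<lambda>t. (?P t * (1 - t\<^sup>2) + t * (1 - t\<^sup>2) powr (1 - \<alpha>)) / (1 - r * t)\<^sup>2"
  let ?b = "\<lambda>t. t * ?P t * (2 * (r - t)) / (1 - r * t) ^ 3"
  let ?s3 = "\<lambda>t. 2 * t * (t * ?P t) / (1 - r * t) ^ 3"
  let ?s2 = "\<lambda>t. t * ?P t / (1 - r * t)\<^sup>2"
  have den: "1 - r * t > 0" if "t \<in> {0..<1}" for t using one_minus_mult_pos[OF r] that by auto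
  have ia: "set_integrable lborel {0..<1} ?a"
  proof -
    have "set_integrable lborel {0..<1} (\<lambda>t. ?P t * (1 - t\<^sup>2) / (1 - r * t)\<^sup>2 + (1 - t\<^sup>2) powr (1 - \<alpha>) * t / (1 - r * t)\<^sup>2)"
      by (intro set_integral_add K set_integrable_P_fun[OF \<alpha>1 \<alpha>2] set_integrable_one_minus_sq_powr[OF \<alpha>1 \<alpha>2] continuous_intros)
    then show ?thesis by (simp add: add_divide_distrib mult.commute)
  qed
  have ib: "set_integrable lborel {0..<1} ?b"
    using K[OF set_integrable_P_fun[OF \<alpha>1 \<alpha>2], of "\<lambda>t. t * (2 * (r - t))" 3] by (simp add: continuous_intros mult_ac)
  have is3: "set_integrable lborel {0..<1} ?s3"
    using K[OF set_integrable_P_fun[OF \<alpha>1 \<alpha>2], of "\<lambda>t. 2 * t * t" 3] by (simp add: continuous_intros mult_ac)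
  have is2: "set_integrable lborel {0..<1} ?s2"
    using K[OF set_integrable_P_fun[OF \<alpha>1 \<alpha>2], of "\<lambda>t. t" 2] by (simp add: continuous_intros mult_ac)
  have lim: "(?G \<longlongrightarrow> 0) (at_left 1)"
  proof -
    have "((\<lambda>t. ((1 - t) * ?P t) * (t * (1 + t) / (1 - r * t)\<^sup>2)) \<longlongrightarrow> 0 * (1 * (1 + 1) / (1 - r * 1)\<^sup>2)) (at_left 1)"
      by (intro tendsto_intros P_fun_times_vanishing \<alpha>1 \<alpha>2) (use r in auto)
    then show ?thesis by (simp add: power2_eq_square algebra_simps)
  qed
  have "?I (\<lambda>t. ?a t + ?b t) = 0 - ?G 0"
  proof (rule FTC_half_open[OF _ _ _ lim])
    show "continuous_on {0..<1} ?G"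
      using den by (intro continuous_intros continuous_on_P_fun) force
    show "(?G has_real_derivative ?a t + ?b t) (at t)" if t: "0 < t" "t < 1" for t
    proof -
      define u where "u = 1 - r * t"
      define v where "v = 1 - t\<^sup>2"
      have u: "u > 0" using den[of t] t by (simp add: u_def)
      have v: "v > 0" using one_minus_sq_pos[of t] t by (simp add: v_def)
      have "((\<lambda>t. t * ?P t) has_real_derivative ?P t + t * v powr (- \<alpha>)) (at t)"
        unfolding v_def using t by (auto intro!: derivative_eq_intros P_fun_deriv)
      moreover have "((\<lambda>t. (1 - t\<^sup>2) / (1 - r * t)\<^sup>2) has_real_derivative 2 * (r - t) / u ^ 3) (at t)"
      proof -
        have "((\<lambda>t. (1 - t\<^sup>2) / (1 - r * t)\<^sup>2) has_real_derivative
            ((- 2 * t) * u\<^sup>2 - (1 - t\<^sup>2) * (2 * u * (- r))) / (u\<^sup>2 * u\<^sup>2)) (at t)"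
          using u unfolding u_def by (auto intro!: derivative_eq_intros simp: power2_eq_square)
        also have "((- 2 * t) * u\<^sup>2 - (1 - t\<^sup>2) * (2 * u * (- r))) = u * (2 * (r - t))"
          unfolding u_def by algebra
        also have "u * (2 * (r - t)) / (u\<^sup>2 * u\<^sup>2) = 2 * (r - t) / u ^ 3"
          using u by (simp add: power2_eq_square power3_eq_cube)
        finally show ?thesis .
      qed
      ultimately have "((\<lambda>t. t * ?P t * ((1 - t\<^sup>2) / (1 - r * t)\<^sup>2)) has_real_derivative
          (?P t + t * v powr (- \<alpha>)) * ((1 - t\<^sup>2) / (1 - r * t)\<^sup>2) + 2 * (r - t) / u ^ 3 * (t * ?P t)) (at t)"
        by (rule DERIV_mult)
      also have "(?P t + t * v powr (- \<alpha>)) * ((1 - t\<^sup>2) / (1 - r * t)\<^sup>2) + 2 * (r - t) / u ^ 3 * (t * ?P t) =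
          ?a t + ?b t"
      proof -
        have "(?P t + t * v powr (- \<alpha>)) * (1 - t\<^sup>2) = ?P t * (1 - t\<^sup>2) + t * (1 - t\<^sup>2) powr (1 - \<alpha>)"
          unfolding powr_one_minus[OF less_imp_le[OF v[unfolded v_def]]]
          by (simp add: v_def algebra_simps)
        then show ?thesis unfolding u_def by (simp add: mult.commute)
      qed
      finally show ?thesis by (simp add: mult.assoc)
    qed
  qed (intro set_integral_add ia ib)
  then have ab: "?I ?a = - ?I ?b" using set_integral_add(2)[OF ia ib] by simp
  have "(1 - r\<^sup>2) * ?I ?s3 - 2 * \<alpha> * r * ?I ?s2 = ?I (\<lambda>t. (1 - r\<^sup>2) * ?s3 t - 2 * \<alpha> * r * ?s2 t)"
    using set_integral_diff(2)[OF set_integrable_mult_right[OF is3, of "1 - r\<^sup>2"]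
      set_integrable_mult_right[OF is2, of "2 * \<alpha> * r"]]
    by (simp only: set_integral_mult_right)
  also have "\<dots> = ?I (\<lambda>t. (-1) * ?b t - 2 * (\<alpha> - 1) * r * ?s2 t)"
  proof (rule set_lebesgue_integral_cong)
    show "\<forall>t. t \<in> {0..<1} \<longrightarrow> (1 - r\<^sup>2) * ?s3 t - 2 * \<alpha> * r * ?s2 t = (-1) * ?b t - 2 * (\<alpha> - 1) * r * ?s2 t"
    proof (intro allI impI)
      fix t :: real assume t: "t \<in> {0..<1}"
      define u where "u = 1 - r * t"
      have u: "u > 0" using den[OF t] by (simp add: u_def)
      have s2: "?s2 t = t * ?P t * u / u ^ 3"
        using u unfolding u_def[symmetric] by (simp add: power2_eq_square power3_eq_cube)
      have "(1 - r\<^sup>2) * (2 * t * (t * ?P t)) - 2 * \<alpha> * r * (t * ?P t * u) =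
          (-1) * (t * ?P t * (2 * (r - t))) - 2 * (\<alpha> - 1) * r * (t * ?P t * u)"
        unfolding u_def by algebra
      from arg_cong[OF this, of "\<lambda>x. x / u ^ 3"] show "(1 - r\<^sup>2) * ?s3 t - 2 * \<alpha> * r * ?s2 t = (-1) * ?b t - 2 * (\<alpha> - 1) * r * ?s2 t"
        unfolding s2 unfolding u_def[symmetric] by (simp only: diff_divide_distrib times_divide_eq_right)
    qed
  qed auto
  also have "\<dots> = ?I ?a - 2 * (\<alpha> - 1) * r * ?I ?s2"
    using set_integral_diff(2)[OF set_integrable_mult_right[OF ib, of "-1"]
      set_integrable_mult_right[OF is2, of "2 * (\<alpha> - 1) * r"]]
    by (simp only: set_integral_mult_right ab)
  also have "\<dots> = ?I (\<lambda>t. ?a t - 2 * (\<alpha> - 1) * r * ?s2 t)"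
    using set_integral_diff(2)[OF ia set_integrable_mult_right[OF is2, of "2 * (\<alpha> - 1) * r"]]
    by (simp only: set_integral_mult_right)
  also have "\<dots> = D_slope \<alpha> r"
    unfolding D_slope_def
  proof (rule set_lebesgue_integral_cong)
    show "\<forall>t. t \<in> {0..<1} \<longrightarrow> ?a t - 2 * (\<alpha> - 1) * r * ?s2 t =
        (?P t * (1 - t\<^sup>2 + 2 * (\<alpha> - 1) * t * (t - r)) + 2 * (\<alpha> - 1) * t * P_defect \<alpha> t) / (1 - r * t)\<^sup>2"
    proof (intro allI impI)
      fix t :: real
      have A: "(1 - t\<^sup>2) powr (1 - \<alpha>) = 2 * (\<alpha> - 1) * (t * ?P t + P_defect \<alpha> t)"
        using \<alpha>1 by (simp add: P_defect_def)
      have "?P t * (1 - t\<^sup>2) + t * (1 - t\<^sup>2) powr (1 - \<alpha>) - 2 * (\<alpha> - 1) * r * (t * ?P t) =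
          ?P t * (1 - t\<^sup>2 + 2 * (\<alpha> - 1) * t * (t - r)) + 2 * (\<alpha> - 1) * t * P_defect \<alpha> t"
        unfolding A by (simp add: algebra_simps)
      then show "?a t - 2 * (\<alpha> - 1) * r * ?s2 t =
        (?P t * (1 - t\<^sup>2 + 2 * (\<alpha> - 1) * t * (t - r)) + 2 * (\<alpha> - 1) * t * P_defect \<alpha> t) / (1 - r * t)\<^sup>2"
        by (simp only: times_divide_eq_right diff_divide_distrib[symmetric])
    qed
  qed auto
  finally show ?thesis .
qed

lemma D_fun_deriv:
  assumes "\<bar>r\<bar> < 1"
  shows "(D_fun \<alpha> has_real_derivative (1 - r\<^sup>2) powr (\<alpha> - 1) * D_slope \<alpha> r) (at r)"
  using D_fun_deriv_raw[OF set_integrable_P_fun[OF \<alpha>1 \<alpha>2] assms] D_slope_eq[OF assms] by simp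

lemma D_slope_0_pos: "0 < D_slope \<alpha> 0"
proof -
  have i3: "set_integrable lborel {0..<1} (\<lambda>t::real. 2 * t ^ 3)"
    by (rule set_integrable_subset[OF borel_integrable_atLeastAtMost'[of 0 1]]) (auto intro!: continuous_intros)
  have "(LINT t:{0..<1}|lborel. 2 * t ^ 3) = 1 / 2 - (0::real) ^ 4 / 2"
    by (rule FTC_half_open[OF _ _ i3])
      (auto intro!: continuous_intros derivative_eq_intros tendsto_eq_intros simp: power_numeral_reduce)
  moreover have "(LINT t:{0..<1}|lborel. 2 * t ^ 3) \<le> (LINT t:{0..<1}|lborel. 2 * t * (t * P_fun \<alpha> t))"
  proof (rule set_integral_mono[OF i3])
    show "set_integrable lborel {0..<1} (\<lambda>t. 2 * t * (t * P_fun \<alpha> t))"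
      using set_integrable_mult_continuous[OF set_integrable_P_fun[OF \<alpha>1 \<alpha>2], of "\<lambda>t. 2 * t * t"] by (simp add: continuous_intros mult_ac)
    show "2 * t ^ 3 \<le> 2 * t * (t * P_fun \<alpha> t)" if "t \<in> {0..<1}" for t
      using mult_left_mono[OF P_fun_ge[of \<alpha> t], of "2 * t * t"] that \<alpha>1
      by (simp add: power3_eq_cube mult_ac)
  qed
  ultimately show ?thesis using D_slope_eq[of 0] by simp
qed

text \<open>The defect is nonnegative because its limit is.  In the other term only \<open>t < r\<close> needs an argument:
there \<open>2 * (\<alpha> - 1) * t * (r - t) \<le> 1 - t \<le> 1 - t\<^sup>2\<close>, because
\<open>2 * (\<alpha> - 1) \<le> 1\<close>.\<close>
lemma D_slope_nonneg:
  assumes \<alpha>3: "\<alpha> \<le> 3 / 2" and r: "0 \<le> r" "r < 1"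
  shows "0 \<le> D_slope \<alpha> r"
  unfolding D_slope_def set_lebesgue_integral_def
proof (intro integral_nonneg_AE AE_I2)
  fix t :: real
  show "0 \<le> indicator {0..<1} t *\<^sub>R
      ((P_fun \<alpha> t * (1 - t\<^sup>2 + 2 * (\<alpha> - 1) * t * (t - r)) + 2 * (\<alpha> - 1) * t * P_defect \<alpha> t) / (1 - r * t)\<^sup>2)"
  proof (cases "t \<in> {0..<1}")
    case t: True
    have "0 \<le> P_defect_end \<alpha>"
      unfolding P_defect_end_def using \<alpha>1 \<alpha>3 sq_powr_integral_pos[OF \<alpha>1 \<alpha>2] by simp
    then have h: "0 \<le> P_defect \<alpha> t" using P_defect_end_le[OF \<alpha>1 \<alpha>2, of t] t by simp
    have "2 * (\<alpha> - 1) * (t * (r - t)) \<le> 1 - t\<^sup>2"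
    proof (cases "r \<le> t")
      case True
      then have "t * (r - t) \<le> 0" using t by (simp add: mult_nonneg_nonpos)
      then have "2 * (\<alpha> - 1) * (t * (r - t)) \<le> 0" using \<alpha>1 mult_nonneg_nonpos[of "2 * (\<alpha> - 1)" "t * (r - t)"] by simp
      also have "0 \<le> 1 - t\<^sup>2" using one_minus_sq_pos[of t] t by simp
      finally show ?thesis .
    next
      case False
      then have "2 * (\<alpha> - 1) * (t * (r - t)) \<le> 1 * (1 * (1 - t))"
        using t r \<alpha>1 \<alpha>3 by (intro mult_mono) auto
      also have "\<dots> \<le> 1 - t\<^sup>2" using t by (simp add: power2_eq_square mult_left_le_one_le)
      finally show ?thesis .
    qed
    then have "0 \<le> 1 - t\<^sup>2 + 2 * (\<alpha> - 1) * t * (t - r)" by (simp add: algebra_simps)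
    then show ?thesis using t h P_fun_nonneg[of t \<alpha>] \<alpha>1 by (auto intro!: divide_nonneg_nonneg add_nonneg_nonneg mult_nonneg_nonneg)
  qed simp
qed

lemma D_fun_mono:
  assumes "\<alpha> \<le> 3 / 2" "0 \<le> r" "r \<le> s" "s < 1"
  shows "D_fun \<alpha> r \<le> D_fun \<alpha> s"
proof (rule DERIV_nonneg_imp_nondecreasing[OF assms(3)])
  fix x assume "r \<le> x" "x \<le> s"
  then show "\<exists>y. (D_fun \<alpha> has_real_derivative y) (at x) \<and> 0 \<le> y"
    using D_fun_deriv[of x] D_slope_nonneg[of x] assms
    by (intro exI[of _ "(1 - x\<^sup>2) powr (\<alpha> - 1) * D_slope \<alpha> x"]) auto
qed

text \<open>Both \<open>1 - t\<^sup>2\<close> and \<open>\<bar>t - r\<bar>\<close> are bounded by a multiple of \<open>1 - r * t\<close>, so the part with \<open>P_fun\<close> loses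
one power of the kernel and vanishes by \<open>Cauchy_integral_vanishing\<close>.  In the part with \<open>P_defect\<close> an
integration by parts with \<open>t / (1 - r * t)\<close>, the antiderivative of \<open>1 / (1 - r * t)\<^sup>2\<close>, extracts the
endpoint value and leaves another integral of the same vanishing kind.\<close>
lemma D_slope_times_tendsto:
  "((\<lambda>r. (1 - r) * D_slope \<alpha> r) \<longlongrightarrow> 2 * (\<alpha> - 1) * P_defect_end \<alpha>) (at_left 1)"
proof -
  let ?I = "\<lambda>f. LINT t:{0..<1}|lborel. f t"
  let ?P = "P_fun \<alpha>" and ?h = "P_defect \<alpha>"
  (* V and U are what remains of the two parts after one power of the kernel is taken out. *)
  define V where "V r t = ?P t * ((1 - t\<^sup>2 + 2 * (\<alpha> - 1) * t * (t - r)) / (1 - r * t))" for r t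
  define U where "U t = t * (?h t - t * ?P t)" for t
  have den: "1 - r * t > 0" if "r \<in> {0..<1}" "t \<in> {0..1}" for r t :: real
    using one_minus_mult_pos[of r t] that by auto
  have iU: "set_integrable lborel {0..<1} U"
  proof -
    have "set_integrable lborel {0..<1} (\<lambda>t. ?h t * t - ?P t * t\<^sup>2)"
      by (intro set_integral_diff set_integrable_mult_continuous set_integrable_P_defect set_integrable_P_fun[OF \<alpha>1 \<alpha>2] continuous_intros)
    then show ?thesis unfolding U_def[abs_def] by (simp add: algebra_simps power2_eq_square)
  qed
  have iV: "set_integrable lborel {0..<1} (V r)" if "r \<in> {0..<1}" for r
    unfolding V_def[abs_def]
    using den[OF that] by (intro set_integrable_mult_continuous[OF set_integrable_P_fun[OF \<alpha>1 \<alpha>2]] continuous_intros) force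
  have bV: "\<bar>V r t\<bar> \<le> 4 * ?P t" if r: "r \<in> {0..<1}" and t: "t \<in> {0..<1}" for r t
  proof -
    have "t * (r * t) \<le> t * (1 * 1)" using r t by (intro mult_left_mono mult_mono) auto
    have rt: "r * t \<le> t" using r t by (simp add: mult_left_le_one_le)
    have "1 - t\<^sup>2 \<le> 2 * (1 - t)" using zero_le_power2[of "1 - t"] by (simp add: power2_eq_square algebra_simps)
    then have 1: "\<bar>1 - t\<^sup>2\<bar> \<le> 2 * (1 - r * t)" using rt one_minus_sq_pos[of t] t by auto
    have "0 \<le> (1 + r) * (1 - t)" "0 \<le> (1 - r) * (1 + t)" using r t by auto
    then have "\<bar>t - r\<bar> \<le> 1 - r * t" by (simp add: abs_le_iff algebra_simps)
    moreover have "2 * (\<alpha> - 1) * t \<le> 2 * 1"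
      using \<alpha>1 \<alpha>2 t by (intro mult_mono) auto
    ultimately have "(2 * (\<alpha> - 1) * t) * \<bar>t - r\<bar> \<le> 2 * (1 - r * t)"
      using t \<alpha>1 by (intro mult_mono) auto
    moreover have "\<bar>2 * (\<alpha> - 1) * t * (t - r)\<bar> = (2 * (\<alpha> - 1) * t) * \<bar>t - r\<bar>"
      using t \<alpha>1 by (simp add: abs_mult)
    ultimately have "\<bar>1 - t\<^sup>2 + 2 * (\<alpha> - 1) * t * (t - r)\<bar> \<le> 4 * (1 - r * t)" using 1 by linarith
    then have "\<bar>(1 - t\<^sup>2 + 2 * (\<alpha> - 1) * t * (t - r)) / (1 - r * t)\<bar> \<le> 4"
      using den[of r t] r t by (simp add: abs_divide divide_le_eq)
    from mult_left_mono[OF this P_fun_nonneg[of t \<alpha>]] show ?thesis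
      using t P_fun_nonneg[of t \<alpha>] unfolding V_def by (simp add: abs_mult mult.commute)
  qed
  let ?W = "\<lambda>r t. V r t - 2 * (\<alpha> - 1) * U t"
  have "((\<lambda>r. (1 - r) * ?I (\<lambda>t. ?W r t / (1 - r * t))) \<longlongrightarrow> 0) (at_left 1)"
  proof (rule Cauchy_integral_vanishing)
    show "set_integrable lborel {0..<1} (?W r)" if "r \<in> {0..<1}" for r
      by (intro set_integral_diff iV that set_integrable_mult_right iU)
    show "set_integrable lborel {0..<1} (\<lambda>t. 4 * ?P t + \<bar>2 * (\<alpha> - 1) * U t\<bar>)"
      by (intro set_integral_add set_integrable_mult_right set_integrable_P_fun[OF \<alpha>1 \<alpha>2] set_integrable_abs iU)
    show "\<bar>?W r t\<bar> \<le> 4 * ?P t + \<bar>2 * (\<alpha> - 1) * U t\<bar>" if "r \<in> {0..<1}" "t \<in> {0..<1}" for r t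
      using bV[OF that] by linarith
  qed
  then have "((\<lambda>r. (1 - r) * ?I (\<lambda>t. ?W r t / (1 - r * t)) + 2 * (\<alpha> - 1) * P_defect_end \<alpha>)
      \<longlongrightarrow> 0 + 2 * (\<alpha> - 1) * P_defect_end \<alpha>) (at_left 1)"
    by (intro tendsto_add tendsto_const)
  then have lim: "((\<lambda>r. (1 - r) * ?I (\<lambda>t. ?W r t / (1 - r * t)) + 2 * (\<alpha> - 1) * P_defect_end \<alpha>)
      \<longlongrightarrow> 2 * (\<alpha> - 1) * P_defect_end \<alpha>) (at_left 1)" by simp
  have N_eq: "(1 - r) * ?I (\<lambda>t. ?W r t / (1 - r * t)) + 2 * (\<alpha> - 1) * P_defect_end \<alpha> = (1 - r) * D_slope \<alpha> r"
    if r: "r \<in> {0..<1}" for r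
  proof -
    have r': "\<bar>r\<bar> < 1" using r by auto
    note K = set_integrable_Cauchy_kernel_mult[OF _ _ r']
    let ?G = "\<lambda>t. t * ?h t * (t / (1 - r * t))"
    let ?a = "\<lambda>t. t * ?h t / (1 - r * t)\<^sup>2"
    let ?b = "\<lambda>t. U t / (1 - r * t)"
    have ia: "set_integrable lborel {0..<1} ?a"
      using K[OF set_integrable_P_defect, of "\<lambda>t. t" 2] by (simp add: continuous_intros mult_ac)
    have ib: "set_integrable lborel {0..<1} ?b"
      using K[OF iU, of "\<lambda>t. 1" 1] by simp
    have iv: "set_integrable lborel {0..<1} (\<lambda>t. V r t / (1 - r * t))"
      using K[OF iV[OF r], of "\<lambda>t. 1" 1] by simp
    have "?I (\<lambda>t. ?a t + ?b t) = 1 * P_defect_end \<alpha> * (1 / (1 - r * 1)) - ?G 0"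
    proof (rule FTC_half_open)
      show "continuous_on {0..<1} ?G"
        using den[OF r] by (intro continuous_intros continuous_on_P_defect \<alpha>1 \<alpha>2) force
      show "(?G \<longlongrightarrow> 1 * P_defect_end \<alpha> * (1 / (1 - r * 1))) (at_left 1)"
        using r by (intro tendsto_intros P_defect_tendsto \<alpha>1 \<alpha>2) auto
      show "(?G has_real_derivative ?a t + ?b t) (at t)" if t: "0 < t" "t < 1" for t
      proof -
        define u where "u = 1 - r * t"
        have u: "u > 0" using den[OF r, of t] t by (simp add: u_def)
        have "((\<lambda>t. t * ?h t) has_real_derivative ?h t - t * ?P t) (at t)"
          using t by (auto intro!: derivative_eq_intros P_defect_deriv \<alpha>1 \<alpha>2)
        moreover have "((\<lambda>t. t / (1 - r * t)) has_real_derivative 1 / u\<^sup>2) (at t)"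
          using u unfolding u_def by (auto intro!: derivative_eq_intros simp: power2_eq_square)
        ultimately have "(?G has_real_derivative (?h t - t * ?P t) * (t / (1 - r * t)) + 1 / u\<^sup>2 * (t * ?h t)) (at t)"
          by (rule DERIV_mult)
        then show ?thesis unfolding U_def u_def by (simp add: mult_ac add.commute)
      qed
    qed (intro set_integral_add ia ib)
    then have "?I ?a + ?I ?b = P_defect_end \<alpha> / (1 - r)" using set_integral_add(2)[OF ia ib] by simp
    then have Ia: "(1 - r) * ?I ?a = P_defect_end \<alpha> - (1 - r) * ?I ?b" using r by (simp add: field_simps)
    have Veq: "V r t / (1 - r * t) =
        ?P t * (1 - t\<^sup>2 + 2 * (\<alpha> - 1) * t * (t - r)) / (1 - r * t)\<^sup>2" for t
      by (simp add: V_def power2_eq_square)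
    have "D_slope \<alpha> r = ?I (\<lambda>t. V r t / (1 - r * t) + 2 * (\<alpha> - 1) * ?a t)"
      unfolding D_slope_def Veq by (simp only: add_divide_distrib times_divide_eq_right mult.assoc)
    also have "\<dots> = ?I (\<lambda>t. V r t / (1 - r * t)) + 2 * (\<alpha> - 1) * ?I ?a"
      using set_integral_add(2)[OF iv set_integrable_mult_right[OF ia, of "2 * (\<alpha> - 1)"]]
      by (simp only: set_integral_mult_right)
    finally have Neq: "D_slope \<alpha> r = ?I (\<lambda>t. V r t / (1 - r * t)) + 2 * (\<alpha> - 1) * ?I ?a" .
    have N: "(1 - r) * D_slope \<alpha> r =
        (1 - r) * ?I (\<lambda>t. V r t / (1 - r * t)) + 2 * (\<alpha> - 1) * ((1 - r) * ?I ?a)"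
      unfolding Neq by (simp add: algebra_simps)
    have "?I (\<lambda>t. ?W r t / (1 - r * t)) = ?I (\<lambda>t. V r t / (1 - r * t) - 2 * (\<alpha> - 1) * ?b t)"
      by (simp add: diff_divide_distrib)
    also have "\<dots> = ?I (\<lambda>t. V r t / (1 - r * t)) - 2 * (\<alpha> - 1) * ?I ?b"
      using set_integral_diff(2)[OF iv set_integrable_mult_right[OF ib, of "2 * (\<alpha> - 1)"]]
      by (simp only: set_integral_mult_right)
    finally have Weq: "?I (\<lambda>t. ?W r t / (1 - r * t)) =
        ?I (\<lambda>t. V r t / (1 - r * t)) - 2 * (\<alpha> - 1) * ?I ?b" .
    show ?thesis unfolding N Ia Weq by (simp add: algebra_simps)
  qed
  show ?thesis
  proof (rule Lim_transform_eventually[OF lim])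
    show "\<forall>\<^sub>F r in at_left 1. (1 - r) * ?I (\<lambda>t. ?W r t / (1 - r * t)) + 2 * (\<alpha> - 1) * P_defect_end \<alpha>
        = (1 - r) * D_slope \<alpha> r"
      using eventually_at_left_1 by eventually_elim (rule N_eq, simp)
  qed
qed

lemma D_fun_strictly_decreasing_near_1:
  assumes "3 / 2 < \<alpha>"
  obtains r0 where "0 < r0" "r0 < 1" "\<And>r s. r0 \<le> r \<Longrightarrow> r < s \<Longrightarrow> s < 1 \<Longrightarrow> D_fun \<alpha> s < D_fun \<alpha> r"
proof -
  have "2 * (\<alpha> - 1) * P_defect_end \<alpha> < 0"
    unfolding P_defect_end_def using assms sq_powr_integral_pos[OF \<alpha>1 \<alpha>2] by (simp add: mult_neg_pos)
  from order_tendstoD(2)[OF D_slope_times_tendsto this]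
  have "\<forall>\<^sub>F r in at_left 1. (1 - r) * D_slope \<alpha> r < 0" .
  then obtain b where b: "b < 1" "\<And>r. b < r \<Longrightarrow> r < 1 \<Longrightarrow> (1 - r) * D_slope \<alpha> r < 0"
    unfolding eventually_at_left_field by blast
  define r0 where "r0 = (max b 0 + 1) / 2"
  have r0: "0 < r0" "r0 < 1" "b < r0" using b(1) by (auto simp: r0_def)
  show ?thesis
  proof (rule that[OF r0(1,2)])
    fix r s assume rs: "r0 \<le> r" "r < s" "s < 1"
    show "D_fun \<alpha> s < D_fun \<alpha> r"
    proof (rule DERIV_neg_imp_decreasing[OF rs(2)])
      fix x assume x: "r \<le> x" "x \<le> s"
      have "D_slope \<alpha> x < 0" using b(2)[of x] x rs r0 by (simp add: mult_less_0_iff)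
      moreover have "0 < (1 - x\<^sup>2) powr (\<alpha> - 1)" using one_minus_sq_pos[of x] x rs r0 by simp
      ultimately show "\<exists>y. (D_fun \<alpha> has_real_derivative y) (at x) \<and> y < 0"
        using D_fun_deriv[of x] x rs r0
        by (intro exI[of _ "(1 - x\<^sup>2) powr (\<alpha> - 1) * D_slope \<alpha> x"]) (auto simp: mult_pos_neg)
    qed
  qed
qed

end

section \<open>The limit and the supremum of D\<close>
lemma set_integral_one_over_square:
  fixes r :: real
  assumes "0 \<le> r" "r < 1"
  shows "set_integrable lborel {0..<1} (\<lambda>t. 1 / (1 - r * t)\<^sup>2)"
    and "(LINT t:{0..<1}|lborel. 1 / (1 - r * t)\<^sup>2) = 1 / (1 - r)"
proof -
  have den: "1 - r * t > 0" if "t \<in> {0..1}" for t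
    using one_minus_mult_pos[of r t] that assms by auto
  show int: "set_integrable lborel {0..<1} (\<lambda>t. 1 / (1 - r * t)\<^sup>2)"
    by (rule set_integrable_subset[OF borel_integrable_atLeastAtMost'[of 0 1]])
      (use den in \<open>force intro!: continuous_intros\<close>)+
  have "(LINT t:{0..<1}|lborel. 1 / (1 - r * t)\<^sup>2) = 1 / (1 - r * 1) - 0 / (1 - r * 0)"
  proof (rule FTC_half_open[OF _ _ int])
    show "continuous_on {0..<1} (\<lambda>t. t / (1 - r * t))"
      using den by (intro continuous_intros) force
    show "((\<lambda>t. t / (1 - r * t)) \<longlongrightarrow> 1 / (1 - r * 1)) (at_left 1)"
      using assms by (intro tendsto_intros) auto
    show "((\<lambda>t. t / (1 - r * t)) has_real_derivative 1 / (1 - r * t)\<^sup>2) (at t)" if "0 < t" "t < 1" for t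
      using den[of t] that by (auto intro!: derivative_eq_intros simp: power2_eq_square)
  qed
  then show "(LINT t:{0..<1}|lborel. 1 / (1 - r * t)\<^sup>2) = 1 / (1 - r)" by simp
qed

lemma one_minus_sq_powr_divide:
  fixes r \<alpha> :: real
  assumes "0 \<le> r" "r < 1"
  shows "(1 - r\<^sup>2) powr \<alpha> * (1 / (1 - r)) = (1 + r) * (1 - r\<^sup>2) powr (\<alpha> - 1)"
proof -
  have p: "(1 - r\<^sup>2) powr \<alpha> = (1 - r\<^sup>2) * (1 - r\<^sup>2) powr (\<alpha> - 1)"
    using powr_one_minus[of "1 - r\<^sup>2" "1 - \<alpha>"] one_minus_sq_pos[OF assms] by simp
  have q: "(1 - r\<^sup>2) * (1 / (1 - r)) = 1 + r"
    using assms by (simp add: power2_eq_square field_simps)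
  show ?thesis unfolding p q[symmetric] by (simp only: mult_ac)
qed

lemma Gamma_reflection_real:
  shows "Gamma x * Gamma (1 - x) = pi / sin (pi * x :: real)"
proof -
  have "complex_of_real (Gamma x * Gamma (1 - x)) = Gamma (of_real x) * Gamma (1 - of_real x)"
    by (simp only: of_real_mult Gamma_complex_of_real[symmetric] of_real_diff of_real_1)
  also have "\<dots> = of_real pi / sin (of_real pi * of_real x)"
    by (rule Gamma_reflection_complex)
  also have "\<dots> = complex_of_real (pi / sin (pi * x))"
    by (simp only: of_real_divide sin_of_real[symmetric] of_real_mult)
  finally have "complex_of_real (Gamma x * Gamma (1 - x)) = complex_of_real (pi / sin (pi * x))" .
  then show ?thesis by (simp only: of_real_eq_iff)
qed

context
  fixes \<alpha> :: real
  assumes \<alpha>1: "1 < \<alpha>" and \<alpha>2: "\<alpha> < 2"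
begin

text \<open>The disc automorphism \<open>t = (r + u) / (1 + r * u)\<close> with \<open>u = 2 * x - 1\<close>; it satisfies
\<open>dt / (1 - r * t)\<^sup>2 = du / (1 - r\<^sup>2)\<close>, so the kernel disappears and \<open>r\<close> survives only in a bounded
factor and in the lower limit of integration.\<close>
lemma moebius_substitution:
  assumes r: "0 \<le> r" "r < 1"
  shows "(1 - r\<^sup>2) powr \<alpha> * (LINT t:{0..<1}|lborel. (1 - t\<^sup>2) powr (1 - \<alpha>) / (1 - r * t)\<^sup>2) =
    (LINT x:{(1 - r) / 2..1}|lborel. 2 * (4 * x * (1 - x)) powr (1 - \<alpha>) * (1 - r + 2 * r * x) powr (2 * \<alpha> - 2))"
proof -
  let ?f = "\<lambda>t. (1 - t\<^sup>2) powr (1 - \<alpha>) / (1 - r * t)\<^sup>2"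
  let ?a = "(1 - r) / 2"
  define d where "d x = 1 - r + 2 * r * x" for x
  define g where "g x = (r - 1 + 2 * x) / d x" for x
  define g' where "g' x = 2 * (1 - r\<^sup>2) / (d x)\<^sup>2" for x
  have r2: "0 < 1 - r\<^sup>2" using one_minus_sq_pos[of r] r by simp
  have d: "d x > 0" if "x \<in> {?a..1}" for x
    using that r by (auto simp: d_def intro!: add_pos_nonneg)
  have g0: "g ?a = 0" and g1: "g 1 = 1" using r by (auto simp: g_def d_def field_simps)
  have f: "set_integrable lborel {0..<1} ?f"
    using set_integrable_Cauchy_kernel_mult[OF set_integrable_one_minus_sq_powr[OF \<alpha>1 \<alpha>2] continuous_on_const[of _ 1], of r 2] r
    by simp
  have f1: "set_integrable lborel {g ?a..g 1} ?f"
    unfolding g0 g1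
  proof -
    have sub: "({0..<1} - {0..1}) \<union> ({0..1} - {0..<1}) \<subseteq> {1::real}" by auto
    have "set_integrable lborel {0..<1} ?f \<longleftrightarrow> set_integrable lborel {0..1} ?f"
      by (rule set_integrable_discrete_difference[OF _ sub]) simp_all
    then show "set_integrable lborel {0..1} ?f" using f by blast
  qed
  have dg: "(g has_real_derivative g' x) (at x)" if "x \<in> {?a..1}" for x
  proof -
    have "(g has_real_derivative (2 * d x - (r - 1 + 2 * x) * (2 * r)) / (d x * d x)) (at x)"
      using d[OF that] unfolding g_def d_def by (auto intro!: derivative_eq_intros)
    also have "2 * d x - (r - 1 + 2 * x) * (2 * r) = 2 * (1 - r\<^sup>2)" unfolding d_def by algebra
    finally show ?thesis by (simp add: g'_def power2_eq_square)
  qed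
  have cg': "continuous_on {?a..1} g'"
    unfolding g'_def d_def[abs_def] using d by (intro continuous_intros) (force simp: d_def)
  have g'nn: "0 \<le> g' x" for x using r2 by (simp add: g'_def)
  have a1: "?a \<le> 1" using r by simp
  have eq: "(1 - r\<^sup>2) powr \<alpha> * (?f (g x) * g' x) = 2 * (4 * x * (1 - x)) powr (1 - \<alpha>) * d x powr (2 * \<alpha> - 2)"
    if x: "x \<in> {?a..1}" for x
  proof -
    have dx: "d x > 0" using d[OF x] .
    have x01: "0 \<le> x" "x \<le> 1" using x r by auto
    have e1: "1 - (g x)\<^sup>2 = (1 - r\<^sup>2) * (4 * x * (1 - x)) / (d x)\<^sup>2"
    proof -
      have "(d x)\<^sup>2 - (r - 1 + 2 * x)\<^sup>2 = (1 - r\<^sup>2) * (4 * x * (1 - x))" unfolding d_def by algebra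
      then show ?thesis using dx by (simp add: g_def power_divide field_simps)
    qed
    have e2: "1 - r * g x = (1 - r\<^sup>2) / d x"
    proof -
      have "d x - r * (r - 1 + 2 * x) = 1 - r\<^sup>2" unfolding d_def by algebra
      then show ?thesis using dx by (simp add: g_def field_simps)
    qed
    have p1: "(1 - (g x)\<^sup>2) powr (1 - \<alpha>) =
        (1 - r\<^sup>2) powr (1 - \<alpha>) * (4 * x * (1 - x)) powr (1 - \<alpha>) * d x powr (2 * \<alpha> - 2)"
    proof -
      have "((d x)\<^sup>2) powr (1 - \<alpha>) = d x powr (2 * (1 - \<alpha>))"
        using dx by (simp add: powr_powr flip: powr_numeral)
      also have "\<dots> = inverse (d x powr (2 * \<alpha> - 2))" by (simp add: powr_minus[symmetric] algebra_simps)
      finally have dp: "((d x)\<^sup>2) powr (1 - \<alpha>) = inverse (d x powr (2 * \<alpha> - 2))" .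
      show ?thesis
        unfolding e1 powr_divide powr_mult[of "1 - r\<^sup>2"] dp by (simp only: divide_inverse inverse_inverse_eq)
    qed
    have p2: "(1 - r\<^sup>2) powr \<alpha> * (1 - r\<^sup>2) powr (1 - \<alpha>) = 1 - r\<^sup>2"
      using r2 by (simp flip: powr_add)
    have "(1 - r\<^sup>2) powr \<alpha> * (?f (g x) * g' x) =
        ((1 - r\<^sup>2) powr \<alpha> * (1 - r\<^sup>2) powr (1 - \<alpha>)) * ((4 * x * (1 - x)) powr (1 - \<alpha>) * d x powr (2 * \<alpha> - 2)) *
        (g' x / (1 - r * g x)\<^sup>2)"
      unfolding p1 by simp
    also have "g' x / (1 - r * g x)\<^sup>2 = 2 / (1 - r\<^sup>2)"
    proof -
      have "2 * q / D\<^sup>2 / (q / D)\<^sup>2 = 2 / q" if "q > 0" "D > 0" for q D :: real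
        using that by (simp add: power2_eq_square)
      from this[OF r2 dx] show ?thesis unfolding e2 g'_def .
    qed
    finally show ?thesis unfolding p2 using r2 by simp
  qed
  have "(LINT t:{0..<1}|lborel. ?f t) = (LBINT t. ?f t * indicator {g ?a..g 1} t)"
    using set_integral_half_open_eq_closed[of ?f] f1
    unfolding g0 g1 by (simp add: set_lebesgue_integral_def mult.commute)
  also have "\<dots> = (LBINT x. ?f (g x) * g' x * indicator {?a..1} x)"
    by (rule integral_substitution(2)[OF f1 dg cg' g'nn a1])
  finally have "(1 - r\<^sup>2) powr \<alpha> * (LINT t:{0..<1}|lborel. ?f t) =
      (1 - r\<^sup>2) powr \<alpha> * (LBINT x. ?f (g x) * g' x * indicator {?a..1} x)"
    by (rule arg_cong)
  also have "\<dots> = (LBINT x. (1 - r\<^sup>2) powr \<alpha> * (?f (g x) * g' x * indicator {?a..1} x))"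
    by (simp only: integral_mult_right_zero)
  also have "\<dots> = (LINT x:{?a..1}|lborel. 2 * (4 * x * (1 - x)) powr (1 - \<alpha>) * d x powr (2 * \<alpha> - 2))"
    unfolding set_lebesgue_integral_def
  proof (rule Bochner_Integration.integral_cong[OF refl])
    fix x
    show "(1 - r\<^sup>2) powr \<alpha> * (?f (g x) * g' x * indicator {?a..1} x) =
        indicator {?a..1} x *\<^sub>R (2 * (4 * x * (1 - x)) powr (1 - \<alpha>) * d x powr (2 * \<alpha> - 2))"
      using eq[of x] by (cases "x \<in> {?a..1}") (simp_all only: indicator_simps mult_1_right scaleR_one, simp_all)
  qed
  finally show ?thesis by (simp add: d_def)
qed

text \<open>Dominated convergence after \<open>moebius_substitution\<close>: the limit of the integrand is
\<open>2 * x powr (\<alpha> - 1) * (1 - x) powr (1 - \<alpha>)\<close>, a Beta integrand.\<close>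
lemma singular_part_tendsto:
  "((\<lambda>r. (1 - r\<^sup>2) powr \<alpha> * (LINT t:{0..<1}|lborel. (1 - t\<^sup>2) powr (1 - \<alpha>) / (1 - r * t)\<^sup>2))
    \<longlongrightarrow> 2 * (\<alpha> - 1) * (pi / sin (pi * (\<alpha> - 1)))) (at_left 1)"
proof -
  define s where "s r x = indicator {(1 - r) / 2..1} x *
    (2 * (4 * x * (1 - x)) powr (1 - \<alpha>) * (1 - r + 2 * r * x) powr (2 * \<alpha> - 2))" for r x :: real
  define l where "l x = 2 * (4 * x * (1 - x)) powr (1 - \<alpha>) * (2 * x) powr (2 * \<alpha> - 2)" for x :: real
  have w: "set_integrable lborel {0..1} (\<lambda>x. 2 * 4 powr (1 - \<alpha>) * 2 powr (2 * \<alpha> - 2) * (x powr (2 - \<alpha> - 1) * (1 - x) powr (2 - \<alpha> - 1)))"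
    by (intro set_integrable_mult_right set_integral_Beta) (use \<alpha>2 in auto)
  have bd: "norm (s r x) \<le> 2 * 4 powr (1 - \<alpha>) * 2 powr (2 * \<alpha> - 2) * (x powr (2 - \<alpha> - 1) * (1 - x) powr (2 - \<alpha> - 1))"
    if r: "r \<in> {0..<1}" and x: "x \<in> {0..1}" for r x
  proof -
    have p: "(4 * x * (1 - x)) powr (1 - \<alpha>) = 4 powr (1 - \<alpha>) * x powr (1 - \<alpha>) * (1 - x) powr (1 - \<alpha>)"
      using x by (simp add: powr_mult)
    have rx: "0 \<le> r * x" using r x by auto
    have "r * x \<le> r * 1" using r x by (intro mult_left_mono) auto
    then have "(1 - r + 2 * r * x) powr (2 * \<alpha> - 2) \<le> 2 powr (2 * \<alpha> - 2)"
      using r rx \<alpha>1 by (intro powr_mono2) auto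
    then have "2 * (4 * x * (1 - x)) powr (1 - \<alpha>) * (1 - r + 2 * r * x) powr (2 * \<alpha> - 2) \<le>
        2 * (4 powr (1 - \<alpha>) * x powr (1 - \<alpha>) * (1 - x) powr (1 - \<alpha>)) * 2 powr (2 * \<alpha> - 2)"
      unfolding p by (intro mult_left_mono) auto
    then show ?thesis by (simp add: s_def indicator_def mult_ac)
  qed
  have lim_s: "((\<lambda>r. LINT x:{0..1}|lborel. s r x) \<longlongrightarrow> (LINT x:{0..1}|lborel. l x)) (at 1 within {0..<1})"
  proof (rule set_integral_dominated_convergence_within[OF _ _ w])
    show "set_integrable lborel {0..1} (s r)" if "r \<in> {0..<1}" for r
    proof (rule set_integrable_bound[OF w])
      show "set_borel_measurable lborel {0..1} (s r)"
        by (simp add: set_borel_measurable_def s_def[abs_def])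
      show "AE x in lborel. x \<in> {0..1} \<longrightarrow> norm (s r x) \<le>
          norm (2 * 4 powr (1 - \<alpha>) * 2 powr (2 * \<alpha> - 2) * (x powr (2 - \<alpha> - 1) * (1 - x) powr (2 - \<alpha> - 1)))"
        using bd[OF that] by (intro AE_I2 impI) (force intro: order_trans[OF _ abs_ge_self])
    qed
    show "set_borel_measurable lborel {0..1} l"
      by (simp add: set_borel_measurable_def l_def[abs_def])
    show "((\<lambda>r. s r x) \<longlongrightarrow> l x) (at 1 within {0..<1})" if x: "x \<in> {0..1}" for x
    proof (cases "x = 0")
      case True
      then show ?thesis by (simp add: s_def l_def)
    next
      case False
      then have x0: "0 < x" using x by simp
      have "((\<lambda>r. 2 * (4 * x * (1 - x)) powr (1 - \<alpha>) * (1 - r + 2 * r * x) powr (2 * \<alpha> - 2)) \<longlongrightarrow>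
          2 * (4 * x * (1 - x)) powr (1 - \<alpha>) * (1 - 1 + 2 * 1 * x) powr (2 * \<alpha> - 2)) (at 1 within {0..<1})"
        using x0 by (intro tendsto_intros) auto
      then have lim: "((\<lambda>r. 2 * (4 * x * (1 - x)) powr (1 - \<alpha>) * (1 - r + 2 * r * x) powr (2 * \<alpha> - 2)) \<longlongrightarrow> l x)
          (at 1 within {0..<1})" by (simp add: l_def)
      have "\<forall>\<^sub>F r in at 1 within {0..<1}. 1 - 2 * x < r"
        using order_tendstoD(1)[OF tendsto_ident_at, of "1 - 2 * x" 1] x0 by auto
      then have "\<forall>\<^sub>F r in at 1 within {0..<1}.
          2 * (4 * x * (1 - x)) powr (1 - \<alpha>) * (1 - r + 2 * r * x) powr (2 * \<alpha> - 2) = s r x"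
        by eventually_elim (use x in \<open>auto simp: s_def indicator_def\<close>)
      then show ?thesis by (rule Lim_transform_eventually[OF lim])
    qed
  qed (use bd in auto)
  have s_eq: "(LINT x:{0..1}|lborel. s r x) =
      (1 - r\<^sup>2) powr \<alpha> * (LINT t:{0..<1}|lborel. (1 - t\<^sup>2) powr (1 - \<alpha>) / (1 - r * t)\<^sup>2)" if "r \<in> {0..<1}" for r
  proof -
    have r: "0 \<le> r" "r < 1" using that by auto
    show ?thesis
      unfolding moebius_substitution[OF r] unfolding set_lebesgue_integral_def s_def
      by (rule Bochner_Integration.integral_cong) (use r in \<open>auto simp: indicator_def\<close>)
  qed
  have l_eq: "(LINT x:{0..1}|lborel. l x) = 2 * (\<alpha> - 1) * (pi / sin (pi * (\<alpha> - 1)))"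
  proof -
    have "l x = 2 * (x powr (\<alpha> - 1) * (1 - x) powr (2 - \<alpha> - 1))" if "x \<in> {0..1}" for x
    proof (cases "x = 0")
      case True then show ?thesis by (simp add: l_def)
    next
      case False
      then have x: "0 < x" "0 \<le> 1 - x" using that by auto
      have "(4::real) powr (1 - \<alpha>) = 2 powr (2 - 2 * \<alpha>)"
        using powr_powr[of 2 2 "1 - \<alpha>"] by (simp add: algebra_simps)
      then have "(4::real) powr (1 - \<alpha>) * 2 powr (2 * \<alpha> - 2) = 1" by (simp flip: powr_add)
      moreover have "x powr (1 - \<alpha>) * x powr (2 * \<alpha> - 2) = x powr (\<alpha> - 1)"
        by (simp flip: powr_add)
      moreover have "l x = 2 * (4 powr (1 - \<alpha>) * 2 powr (2 * \<alpha> - 2)) * (x powr (1 - \<alpha>) * x powr (2 * \<alpha> - 2)) * (1 - x) powr (1 - \<alpha>)"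
        using x by (simp add: l_def powr_mult)
      ultimately show ?thesis by simp
    qed
    then have "(LINT x:{0..1}|lborel. l x) = (LINT x:{0..1}|lborel. 2 * (x powr (\<alpha> - 1) * (1 - x) powr (2 - \<alpha> - 1)))"
      by (intro set_lebesgue_integral_cong) auto
    also have "\<dots> = 2 * Beta \<alpha> (2 - \<alpha>)"
      using set_integral_Beta(2)[of \<alpha> "2 - \<alpha>"] \<alpha>1 \<alpha>2 by simp
    also have "\<dots> = 2 * ((\<alpha> - 1) * Gamma (\<alpha> - 1) * Gamma (1 - (\<alpha> - 1)))"
    proof -
      have "Gamma (1 + (\<alpha> - 1)) = (\<alpha> - 1) * Gamma (\<alpha> - 1)"
        using Gamma_plus1[of "\<alpha> - 1"] nonpos_Ints_nonpos[of "\<alpha> - 1"] \<alpha>1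
        by (auto simp: add.commute)
      then show ?thesis by (simp add: Beta_def Gamma_numeral)
    qed
    finally show ?thesis using Gamma_reflection_real[of "\<alpha> - 1"] by (simp add: mult.assoc)
  qed
  have "\<forall>\<^sub>F r in at 1 within {0..<1}. (LINT x:{0..1}|lborel. s r x) =
      (1 - r\<^sup>2) powr \<alpha> * (LINT t:{0..<1}|lborel. (1 - t\<^sup>2) powr (1 - \<alpha>) / (1 - r * t)\<^sup>2)"
    unfolding eventually_at_filter using s_eq by (intro always_eventually allI impI)
  from Lim_transform_eventually[OF lim_s[unfolded l_eq] this]
  show ?thesis by (simp only: tendsto_at_left_1_iff)
qed

text \<open>The bounded function \<open>P_defect\<close> contributes at most a multiple of \<open>(1 - r\<^sup>2) powr \<alpha> / (1 - r)\<close>, which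
tends to 0 because \<open>\<alpha> > 1\<close>.\<close>
lemma D_fun_tendsto: "(D_fun \<alpha> \<longlongrightarrow> pi / sin (pi * (\<alpha> - 1))) (at_left 1)"
proof -
  let ?I = "\<lambda>f. LINT t:{0..<1}|lborel. f t"
  let ?M = "\<lambda>r. (1 - r\<^sup>2) powr \<alpha> * ?I (\<lambda>t. (1 - t\<^sup>2) powr (1 - \<alpha>) / (1 - r * t)\<^sup>2)"
  let ?R = "\<lambda>r. (1 - r\<^sup>2) powr \<alpha> * ?I (\<lambda>t. P_defect \<alpha> t / (1 - r * t)\<^sup>2)"
  define H where "H = P_defect \<alpha> 0 + \<bar>P_defect_end \<alpha>\<bar>"
  have H0: "0 \<le> H" using abs_P_defect_le[OF \<alpha>1 \<alpha>2, of 0] by (simp add: H_def)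
  have ih: "set_integrable lborel {0..<1} (\<lambda>t. P_defect \<alpha> t / (1 - r * t)\<^sup>2)" if "r \<in> {0..<1}" for r
    using set_integrable_Cauchy_kernel_mult[OF set_integrable_P_defect[OF \<alpha>1 \<alpha>2] continuous_on_const[of _ 1], of r 2] that by simp
  have iA: "set_integrable lborel {0..<1} (\<lambda>t. (1 - t\<^sup>2) powr (1 - \<alpha>) / (1 - r * t)\<^sup>2)" if "r \<in> {0..<1}" for r
    using set_integrable_Cauchy_kernel_mult[OF set_integrable_one_minus_sq_powr[OF \<alpha>1 \<alpha>2] continuous_on_const[of _ 1], of r 2] that by simp
  have R: "(?R \<longlongrightarrow> 0) (at_left 1)"
  proof (rule Lim_null_comparison)
    show "\<forall>\<^sub>F r in at_left 1. norm (?R r) \<le> H * (2 * (1 - r\<^sup>2) powr (\<alpha> - 1))"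
      using eventually_at_left_1
    proof eventually_elim
      case r: (elim r)
      then have pos: "0 < 1 - r\<^sup>2" using one_minus_sq_pos by blast
      note sq = set_integral_one_over_square[of r]
      have "\<bar>?I (\<lambda>t. P_defect \<alpha> t / (1 - r * t)\<^sup>2)\<bar> \<le> ?I (\<lambda>t. H * (1 / (1 - r * t)\<^sup>2))"
      proof -
        have "\<bar>?I (\<lambda>t. P_defect \<alpha> t / (1 - r * t)\<^sup>2)\<bar> \<le> ?I (\<lambda>t. \<bar>P_defect \<alpha> t / (1 - r * t)\<^sup>2\<bar>)"
          using set_integral_norm_bound[OF ih, of r] r by simp
        also have "\<dots> \<le> ?I (\<lambda>t. H * (1 / (1 - r * t)\<^sup>2))"
        proof (rule set_integral_mono)
          show "set_integrable lborel {0..<1} (\<lambda>t. \<bar>P_defect \<alpha> t / (1 - r * t)\<^sup>2\<bar>)"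
            by (rule set_integrable_abs[OF ih]) (use r in auto)
          show "set_integrable lborel {0..<1} (\<lambda>t. H * (1 / (1 - r * t)\<^sup>2))"
            by (rule set_integrable_mult_right[OF sq(1)]) (use r in auto)
          show "\<bar>P_defect \<alpha> t / (1 - r * t)\<^sup>2\<bar> \<le> H * (1 / (1 - r * t)\<^sup>2)" if "t \<in> {0..<1}" for t
            using abs_P_defect_le[OF \<alpha>1 \<alpha>2, of t] that unfolding H_def
            by (simp add: abs_divide divide_right_mono)
        qed
        finally show ?thesis .
      qed
      also have "\<dots> = H * (1 / (1 - r))"
        using sq(2) r by (simp only: set_integral_mult_right)
      finally have le: "\<bar>?I (\<lambda>t. P_defect \<alpha> t / (1 - r * t)\<^sup>2)\<bar> \<le> H * (1 / (1 - r))" .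
      have "norm (?R r) = (1 - r\<^sup>2) powr \<alpha> * \<bar>?I (\<lambda>t. P_defect \<alpha> t / (1 - r * t)\<^sup>2)\<bar>"
        by (simp add: abs_mult)
      also have "\<dots> \<le> (1 - r\<^sup>2) powr \<alpha> * (H * (1 / (1 - r)))"
        by (rule mult_left_mono[OF le]) simp
      also have "\<dots> = H * ((1 - r\<^sup>2) powr \<alpha> * (1 / (1 - r)))" by simp
      also have "\<dots> = H * ((1 + r) * (1 - r\<^sup>2) powr (\<alpha> - 1))"
        using r by (simp only: one_minus_sq_powr_divide)
      also have "\<dots> \<le> H * (2 * (1 - r\<^sup>2) powr (\<alpha> - 1))"
        using r H0 by (intro mult_left_mono mult_right_mono) auto
      finally show ?case .
    qed
    have "((\<lambda>r. H * (2 * (1 - r\<^sup>2) powr (\<alpha> - 1))) \<longlongrightarrow> H * (2 * (1 - 1\<^sup>2) powr (\<alpha> - 1))) (at_left (1::real))"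
    proof (intro tendsto_intros tendsto_powr')
      have "\<forall>\<^sub>F r in at_left (1::real). 0 \<le> 1 - r\<^sup>2"
        using eventually_at_left_1 by eventually_elim (use one_minus_sq_pos in force)
      then show "(1::real) - 1\<^sup>2 \<noteq> 0 \<or> 0 < \<alpha> - 1 \<and> (\<forall>\<^sub>F r in at_left (1::real). 0 \<le> 1 - r\<^sup>2)"
        using \<alpha>1 by simp
    qed
    then show "((\<lambda>r. H * (2 * (1 - r\<^sup>2) powr (\<alpha> - 1))) \<longlongrightarrow> 0) (at_left (1::real))" by simp
  qed
  have "((\<lambda>r. ?M r / (2 * (\<alpha> - 1)) - ?R r) \<longlongrightarrow>
      2 * (\<alpha> - 1) * (pi / sin (pi * (\<alpha> - 1))) / (2 * (\<alpha> - 1)) - 0) (at_left 1)"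
    by (intro tendsto_diff tendsto_divide tendsto_const singular_part_tendsto R) (use \<alpha>1 in simp)
  moreover have "2 * (\<alpha> - 1) * (pi / sin (pi * (\<alpha> - 1))) / (2 * (\<alpha> - 1)) - 0 = pi / sin (pi * (\<alpha> - 1))"
    using \<alpha>1 by simp
  ultimately have lim: "((\<lambda>r. ?M r / (2 * (\<alpha> - 1)) - ?R r) \<longlongrightarrow> pi / sin (pi * (\<alpha> - 1))) (at_left 1)"
    by (simp only:)
  have "?M r / (2 * (\<alpha> - 1)) - ?R r = D_fun \<alpha> r" if r: "r \<in> {0..<1}" for r
  proof -
    have "?I (\<lambda>t. t * P_fun \<alpha> t / (1 - r * t)\<^sup>2) =
        ?I (\<lambda>t. (1 - t\<^sup>2) powr (1 - \<alpha>) / (1 - r * t)\<^sup>2 / (2 * (\<alpha> - 1)) - P_defect \<alpha> t / (1 - r * t)\<^sup>2)"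
    proof (rule set_lebesgue_integral_cong)
      have e: "t * P_fun \<alpha> t = (1 - t\<^sup>2) powr (1 - \<alpha>) / (2 * (\<alpha> - 1)) - P_defect \<alpha> t" for t by (simp add: P_defect_def)
      show "\<forall>t. t \<in> {0..<1} \<longrightarrow> t * P_fun \<alpha> t / (1 - r * t)\<^sup>2 =
          (1 - t\<^sup>2) powr (1 - \<alpha>) / (1 - r * t)\<^sup>2 / (2 * (\<alpha> - 1)) - P_defect \<alpha> t / (1 - r * t)\<^sup>2"
        unfolding e by (simp add: diff_divide_distrib mult.commute)
    qed auto
    also have "\<dots> = ?I (\<lambda>t. (1 - t\<^sup>2) powr (1 - \<alpha>) / (1 - r * t)\<^sup>2) / (2 * (\<alpha> - 1)) - ?I (\<lambda>t. P_defect \<alpha> t / (1 - r * t)\<^sup>2)"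
      using set_integral_diff(2)[OF set_integrable_divide[OF iA[OF r], of "2 * (\<alpha> - 1)"] ih[OF r]]
      by (simp only: set_integral_divide_zero)
    finally show ?thesis unfolding D_fun_def by (simp add: right_diff_distrib)
  qed
  then have "\<forall>\<^sub>F r in at_left 1. ?M r / (2 * (\<alpha> - 1)) - ?R r = D_fun \<alpha> r"
    by (intro eventually_mono[OF eventually_at_left_1]) auto
  then show ?thesis by (rule Lim_transform_eventually[OF lim])
qed

lemma D_fun_extension:
  obtains E where "continuous_on {0..1} E" "\<And>r. r \<in> {0..<1} \<Longrightarrow> E r = D_fun \<alpha> r"
    "E 1 = pi / sin (pi * (\<alpha> - 1))"
proof (rule that)
  let ?L = "pi / sin (pi * (\<alpha> - 1))"
  let ?E = "\<lambda>r. if r = 1 then ?L else D_fun \<alpha> r"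
  show "continuous_on {0..1} ?E"
    unfolding continuous_on_def
  proof
    fix x :: real assume x: "x \<in> {0..1}"
    have ev: "\<forall>\<^sub>F r in at x within {0..1}. D_fun \<alpha> r = ?E r" if "x \<noteq> 1"
    proof -
      have "\<forall>\<^sub>F r in at x within {0..1}. r < 1"
        using order_tendstoD(2)[OF tendsto_ident_at, of x 1] x that by auto
      then show ?thesis by eventually_elim auto
    qed
    show "(?E \<longlongrightarrow> ?E x) (at x within {0..1})"
    proof (cases "x = 1")
      case True
      have "at 1 within {0..1} = at_left (1::real)"
        by (rule at_within_nhd[of _ "{0<..}"]) auto
      moreover have "(?E \<longlongrightarrow> ?L) (at_left 1)"
        by (rule Lim_transform_eventually[OF D_fun_tendsto]) (auto simp: eventually_at_filter)
      ultimately show ?thesis using True by simp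
    next
      case False
      have "(D_fun \<alpha> \<longlongrightarrow> D_fun \<alpha> x) (at x)"
        using DERIV_isCont[OF D_fun_deriv[OF \<alpha>1 \<alpha>2, of x]] x False by (auto simp: isCont_def)
      then have "(D_fun \<alpha> \<longlongrightarrow> D_fun \<alpha> x) (at x within {0..1})" by (rule tendsto_within_subset) simp
      then show ?thesis using Lim_transform_eventually[OF _ ev[OF False]] False by simp
    qed
  qed
qed auto

lemma D_fun_bdd_above: "bdd_above (D_fun \<alpha> ` {0..<1})"
proof -
  obtain E where E: "continuous_on {0..1} E" "\<And>r. r \<in> {0..<1} \<Longrightarrow> E r = D_fun \<alpha> r"
    using D_fun_extension by blast
  have "bdd_above (E ` {0..1})"
    using compact_imp_bounded[OF compact_continuous_image[OF E(1) compact_Icc]] by (rule bounded_imp_bdd_above)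
  then have "bdd_above (E ` {0..<1})" by (rule bdd_above_mono) auto
  also have "E ` {0..<1} = D_fun \<alpha> ` {0..<1}" by (rule image_cong[OF refl E(2)])
  finally show ?thesis .
qed

lemma le_SUP_D_fun: "pi / sin (pi * (\<alpha> - 1)) \<le> (SUP r\<in>{0..<1}. D_fun \<alpha> r)"
proof (rule tendsto_upperbound[OF D_fun_tendsto])
  show "\<forall>\<^sub>F r in at_left 1. D_fun \<alpha> r \<le> (SUP r\<in>{0..<1}. D_fun \<alpha> r)"
    using eventually_at_left_1 by eventually_elim (rule cSUP_upper[OF _ D_fun_bdd_above], simp)
qed simp

lemma pi_le_SUP_D_fun: "pi \<le> (SUP r\<in>{0..<1}. D_fun \<alpha> r)"
proof -
  have "0 < sin (pi * (\<alpha> - 1))" using \<alpha>1 \<alpha>2 by (intro sin_gt_zero) auto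
  then have "pi \<le> pi / sin (pi * (\<alpha> - 1))" by (simp add: pos_le_divide_eq mult_left_le)
  then show ?thesis using le_SUP_D_fun by linarith
qed

lemma SUP_D_fun_eq:
  assumes "\<alpha> \<le> 3 / 2"
  shows "(SUP r\<in>{0..<1}. D_fun \<alpha> r) = pi / sin (pi * (\<alpha> - 1))"
proof (rule antisym[OF _ le_SUP_D_fun], rule cSUP_least)
  fix r :: real assume r: "r \<in> {0..<1}"
  show "D_fun \<alpha> r \<le> pi / sin (pi * (\<alpha> - 1))"
  proof (rule tendsto_lowerbound[OF D_fun_tendsto])
    have "\<forall>\<^sub>F s in at_left 1. s \<in> {r<..<1}" using r by (intro eventually_at_left_real) auto
    then show "\<forall>\<^sub>F s in at_left 1. D_fun \<alpha> r \<le> D_fun \<alpha> s"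
      by eventually_elim (use r assms in \<open>auto intro!: D_fun_mono \<alpha>1 \<alpha>2\<close>)
  qed simp
qed auto

text \<open>Near 1 the function decreases strictly towards its limit, so its value at \<open>r0\<close> already exceeds the
limit.\<close>
lemma SUP_D_fun_gt:
  assumes "3 / 2 < \<alpha>"
  shows "pi / sin (pi * (\<alpha> - 1)) < (SUP r\<in>{0..<1}. D_fun \<alpha> r)"
proof -
  obtain r0 where r0: "0 < r0" "r0 < 1" "\<And>r s. r0 \<le> r \<Longrightarrow> r < s \<Longrightarrow> s < 1 \<Longrightarrow> D_fun \<alpha> s < D_fun \<alpha> r"
    using D_fun_strictly_decreasing_near_1[OF \<alpha>1 \<alpha>2 assms] by blast
  define r1 where "r1 = (r0 + 1) / 2"
  have r1: "r0 < r1" "r1 < 1" using r0 by (auto simp: r1_def)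
  have "pi / sin (pi * (\<alpha> - 1)) \<le> D_fun \<alpha> r1"
  proof (rule tendsto_upperbound[OF D_fun_tendsto])
    have "\<forall>\<^sub>F s in at_left 1. s \<in> {r1<..<1}" using r1 by (intro eventually_at_left_real) auto
    then show "\<forall>\<^sub>F s in at_left 1. D_fun \<alpha> s \<le> D_fun \<alpha> r1"
      by eventually_elim (use r0 r1 in \<open>auto intro!: less_imp_le\<close>)
  qed simp
  also have "\<dots> < D_fun \<alpha> r0" using r0 r1 by auto
  also have "\<dots> \<le> (SUP r\<in>{0..<1}. D_fun \<alpha> r)"
    by (rule cSUP_upper[OF _ D_fun_bdd_above]) (use r0 in auto)
  finally show ?thesis .
qed

text \<open>The continuous extension has a maximum on \<open>[0,1]\<close>, which is not at 1 by \<open>SUP_D_fun_gt\<close> and not at 0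
because \<open>D_fun \<alpha>\<close> has positive derivative there.\<close>
lemma SUP_D_fun_attained:
  assumes "3 / 2 < \<alpha>"
  shows "\<exists>r\<in>{0<..<1}. D_fun \<alpha> r = (SUP s\<in>{0..<1}. D_fun \<alpha> s)"
proof -
  let ?S = "SUP s\<in>{0..<1}. D_fun \<alpha> s"
  obtain E where E: "continuous_on {0..1} E" "\<And>r. r \<in> {0..<1} \<Longrightarrow> E r = D_fun \<alpha> r"
      "E 1 = pi / sin (pi * (\<alpha> - 1))"
    using D_fun_extension by blast
  obtain m where m: "m \<in> {0..1}" "\<And>r. r \<in> {0..1} \<Longrightarrow> E r \<le> E m"
    using continuous_attains_sup[OF _ _ E(1)] by auto
  have "?S \<le> E m"
  proof (rule cSUP_least)
    fix r :: real assume "r \<in> {0..<1}"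
    then show "D_fun \<alpha> r \<le> E m" using m(2)[of r] E(2)[of r] by simp
  qed auto
  then have m1: "m \<noteq> 1" using SUP_D_fun_gt[OF assms] E(3) by auto
  then have Em: "E m = D_fun \<alpha> m" using E(2) m(1) by auto
  have "D_fun \<alpha> m \<le> ?S" by (rule cSUP_upper[OF _ D_fun_bdd_above]) (use m m1 in auto)
  then have eq: "D_fun \<alpha> m = ?S" using \<open>?S \<le> E m\<close> Em by simp
  have "m \<noteq> 0"
  proof
    assume "m = 0"
    have "(D_fun \<alpha> has_real_derivative D_slope \<alpha> 0) (at 0)" using D_fun_deriv[OF \<alpha>1 \<alpha>2, of 0] by simp
    from DERIV_pos_inc_right[OF this D_slope_0_pos[OF \<alpha>1 \<alpha>2]]
    obtain d where d: "d > 0" "\<And>h. 0 < h \<Longrightarrow> h < d \<Longrightarrow> D_fun \<alpha> 0 < D_fun \<alpha> h" by auto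
    define h where "h = min d 1 / 2"
    have h: "0 < h" "h < d" "h < 1" using d(1) by (auto simp: h_def)
    have "D_fun \<alpha> h \<le> ?S" by (rule cSUP_upper[OF _ D_fun_bdd_above]) (use h in auto)
    then show False using d(2)[OF h(1,2)] eq \<open>m = 0\<close> by simp
  qed
  then show ?thesis using eq m m1 by (intro bexI[of _ m]) auto
qed

end

section \<open>Bloch functions\<close>
lemma continuous_nonneg_integral_0_imp_0:
  fixes f :: "real \<Rightarrow> real"
  assumes cont: "continuous_on {0..<1} f" and int: "set_integrable lborel {0..<1} f"
    and nn: "\<And>t. t \<in> {0..<1} \<Longrightarrow> 0 \<le> f t" and zero: "(LINT t:{0..<1}|lborel. f t) = 0"
    and t: "t \<in> {0..<1}"
  shows "f t = 0"
proof -
  define b where "b = (1 + t) / 2"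
  have b: "0 < b" "b < 1" "t \<le> b" using t by (auto simp: b_def)
  have intb: "set_integrable lborel {0..b} f" by (rule set_integrable_subset[OF int]) (use b in auto)
  have "(LINT t:{0..b}|lborel. f t) \<le> (LINT t:{0..<1}|lborel. f t)"
    using int intb nn b unfolding set_lebesgue_integral_def set_integrable_def
    by (intro integral_mono) (auto simp: indicator_def)
  moreover have "0 \<le> (LINT t:{0..b}|lborel. f t)"
    unfolding set_lebesgue_integral_def using nn b
    by (intro Bochner_Integration.integral_nonneg) (auto simp: indicator_def)
  ultimately have "(f has_integral 0) (cbox 0 b)"
    using set_borel_integral_eq_integral[OF intb] zero by (simp add: has_integral_integral)
  then show ?thesis
    by (rule has_integral_0_cbox_imp_0[rotated 2])
      (use b t nn in \<open>auto intro: continuous_on_subset[OF cont]\<close>)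
qed

definition bloch_seminorm :: "real \<Rightarrow> (complex \<Rightarrow> complex) \<Rightarrow> real" where
  "bloch_seminorm \<alpha> f = (SUP z\<in>ball 0 1. (1 - (cmod z)\<^sup>2) powr \<alpha> * cmod (deriv f z))"

lemma bloch_norm_eq: "bloch_norm \<alpha> f = cmod (f 0) + bloch_seminorm \<alpha> f"
  by (simp add: bloch_norm_def bloch_seminorm_def)

lemma bloch_seminorm_upper:
  assumes "f \<in> bloch_space \<alpha>" "cmod z < 1"
  shows "(1 - (cmod z)\<^sup>2) powr \<alpha> * cmod (deriv f z) \<le> bloch_seminorm \<alpha> f"
  unfolding bloch_seminorm_def
  by (rule cSUP_upper) (use assms in \<open>auto simp: bloch_space_def\<close>)

lemma bloch_seminorm_nonneg:
  assumes "f \<in> bloch_space \<alpha>" shows "0 \<le> bloch_seminorm \<alpha> f"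
  using bloch_seminorm_upper[OF assms, of 0] by (simp add: order_trans[OF norm_ge_zero])

lemma bloch_seminorm_le:
  assumes "\<And>z. cmod z < 1 \<Longrightarrow> (1 - (cmod z)\<^sup>2) powr \<alpha> * cmod (deriv f z) \<le> K"
  shows "bloch_seminorm \<alpha> f \<le> K"
  unfolding bloch_seminorm_def by (rule cSUP_least) (use assms in auto)

lemma bloch_space_deriv:
  assumes "f \<in> bloch_space \<alpha>" "cmod z < 1"
  shows "(f has_field_derivative deriv f z) (at z)"
  using assms by (intro holomorphic_derivI[of f "ball 0 1"]) (auto simp: bloch_space_def)

lemma bloch_space_continuous:
  assumes "f \<in> bloch_space \<alpha>"
  shows "continuous_on {0..<1} (\<lambda>t. f (complex_of_real t))"
proof -
  have "continuous_on (ball 0 1) f"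
    using assms by (auto simp: bloch_space_def intro: holomorphic_on_imp_continuous_on)
  then show ?thesis
    by (rule continuous_on_compose2) (auto intro!: continuous_intros)
qed

text \<open>On the positive radius \<open>\<bar>f' t\<bar>\<close> is at most the seminorm times the derivative of \<open>P_fun \<alpha>\<close>; the mean
value inequality compares the two functions.\<close>
lemma bloch_growth:
  assumes f: "f \<in> bloch_space \<alpha>" and t: "t \<in> {0..<1}"
  shows "cmod (f (of_real t) - f 0) \<le> bloch_seminorm \<alpha> f * P_fun \<alpha> t"
proof (cases "t = 0")
  case True
  then show ?thesis by (simp add: P_fun_0)
next
  case False
  then have t: "0 < t" "t < 1" using t by auto
  have "norm (f (of_real t) - f (of_real 0)) \<le> bloch_seminorm \<alpha> f * P_fun \<alpha> t - bloch_seminorm \<alpha> f * P_fun \<alpha> 0"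
  proof (rule differentiable_bound_general[OF t(1)])
    show "continuous_on {0..t} (\<lambda>t. f (of_real t))"
      by (rule continuous_on_subset[OF bloch_space_continuous[OF f]]) (use t in auto)
    show "continuous_on {0..t} (\<lambda>t. bloch_seminorm \<alpha> f * P_fun \<alpha> t)"
      by (intro continuous_intros continuous_on_subset[OF continuous_on_P_fun]) (use t in auto)
    fix x assume x: "0 < x" "x < t"
    have "((\<lambda>t. bloch_seminorm \<alpha> f * P_fun \<alpha> t) has_real_derivative bloch_seminorm \<alpha> f * (1 - x\<^sup>2) powr (- \<alpha>)) (at x)"
      using x t by (intro DERIV_cmult P_fun_deriv) auto
    then show "((\<lambda>t. bloch_seminorm \<alpha> f * P_fun \<alpha> t) has_vector_derivative bloch_seminorm \<alpha> f * (1 - x\<^sup>2) powr (- \<alpha>)) (at x)"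
      by (simp add: has_real_derivative_iff_has_vector_derivative)
    show "((\<lambda>t. f (of_real t)) has_vector_derivative deriv f (of_real x)) (at x)"
      by (intro has_vector_derivative_real_field bloch_space_deriv[OF f]) (use x t in auto)
    have pos: "0 < 1 - x\<^sup>2" using one_minus_sq_pos[of x] x t by simp
    have "(1 - x\<^sup>2) powr \<alpha> * cmod (deriv f (of_real x)) \<le> bloch_seminorm \<alpha> f"
      using bloch_seminorm_upper[OF f, of "of_real x"] x t by simp
    then show "cmod (deriv f (of_real x)) \<le> bloch_seminorm \<alpha> f * (1 - x\<^sup>2) powr (- \<alpha>)"
      using pos by (simp add: powr_minus field_simps)
  qed
  then show ?thesis by (simp add: P_fun_0)
qed

text \<open>The principal power is holomorphic where \<open>Re (1 - z\<^sup>2) > 0\<close>; a primitive of it exists on the convex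
disc, and the segment integrals defining \<open>F_fun\<close> evaluate to its increments.\<close>
lemma F_fun_has_derivative:
  assumes "cmod z < 1"
  shows "(F_fun \<alpha> has_field_derivative (1 - z\<^sup>2) powr (- complex_of_real \<alpha>)) (at z)"
proof -
  let ?p = "\<lambda>z. (1 - z\<^sup>2) powr (- complex_of_real \<alpha>)"
  have "?p holomorphic_on ball 0 1"
  proof (intro holomorphic_intros)
    fix z :: complex assume "z \<in> ball 0 1"
    then have "cmod (z\<^sup>2) < 1" by (simp add: norm_power abs_square_less_1)
    then have "0 < Re (1 - z\<^sup>2)" using complex_Re_le_cmod[of "z\<^sup>2"] by simp
    then show "1 - z\<^sup>2 \<notin> \<real>\<^sub>\<le>\<^sub>0" by (auto simp: complex_nonpos_Reals_iff)
  qed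
  then obtain G where G: "\<And>x. x \<in> ball 0 1 \<Longrightarrow> (G has_field_derivative ?p x) (at x within ball 0 1)"
    using holomorphic_convex_primitive'[of "ball 0 1" ?p] by auto
  have eq: "F_fun \<alpha> w = G w - G 0" if "w \<in> ball 0 1" for w
  proof -
    have "closed_segment 0 w \<subseteq> ball 0 1" using that by (intro closed_segment_subset) auto
    then have "(?p has_contour_integral (G (pathfinish (linepath 0 w)) - G (pathstart (linepath 0 w)))) (linepath 0 w)"
      by (intro contour_integral_primitive[OF G]) auto
    then show ?thesis unfolding F_fun_def by (simp add: contour_integral_unique)
  qed
  have "(G has_field_derivative ?p z) (at z)"
    using G[of z] assms by (simp add: at_within_open[of z "ball 0 1"])
  then have "((\<lambda>w. G w - G 0) has_field_derivative ?p z) (at z)"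
    by (auto intro!: derivative_eq_intros)
  then show ?thesis
    by (rule has_field_derivative_transform_within_open[of _ _ _ "ball 0 1"]) (use assms eq in auto)
qed

lemma F_fun_0: "F_fun \<alpha> 0 = 0"
  by (simp add: F_fun_def)

lemma F_fun_holomorphic: "F_fun \<alpha> holomorphic_on ball 0 1"
  unfolding holomorphic_on_def
proof
  fix z :: complex assume "z \<in> ball 0 1"
  then have "(F_fun \<alpha> has_field_derivative (1 - z\<^sup>2) powr (- complex_of_real \<alpha>)) (at z)"
    by (intro F_fun_has_derivative) simp
  then show "F_fun \<alpha> field_differentiable at z within ball 0 1"
    using field_differentiable_at_within field_differentiable_def by blast
qed

text \<open>The difference of the two sides has derivative 0 on \<open>(0,1)\<close> and vanishes at 0.\<close>
lemma F_fun_of_real: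
  assumes t: "t \<in> {0..<1}"
  shows "F_fun \<alpha> (of_real t) = of_real (P_fun \<alpha> t)"
proof (cases "t = 0")
  case True
  then show ?thesis by (simp add: F_fun_0 P_fun_0)
next
  case False
  then have t: "0 < t" "t < 1" using t by auto
  let ?d = "\<lambda>t. F_fun \<alpha> (of_real t) - of_real (P_fun \<alpha> t)"
  have "norm (?d t - ?d 0) \<le> (\<lambda>_. 0::real) t - 0"
  proof (rule differentiable_bound_general[OF t(1)])
    have "continuous_on (ball 0 1) (F_fun \<alpha>)"
      using F_fun_holomorphic by (rule holomorphic_on_imp_continuous_on)
    then have "continuous_on {0..t} (\<lambda>x. F_fun \<alpha> (of_real x))"
      by (rule continuous_on_compose2) (use t in \<open>auto intro!: continuous_intros\<close>)
    moreover have "continuous_on {0..t} (P_fun \<alpha>)"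
      by (rule continuous_on_subset[OF continuous_on_P_fun]) (use t in auto)
    ultimately show "continuous_on {0..t} ?d" by (intro continuous_intros)
    fix x assume x: "0 < x" "x < t"
    have pos: "0 \<le> 1 - x\<^sup>2" using one_minus_sq_pos[of x] x t by simp
    have "((\<lambda>t. F_fun \<alpha> (of_real t)) has_vector_derivative (1 - (of_real x)\<^sup>2) powr (- complex_of_real \<alpha>)) (at x)"
      by (intro has_vector_derivative_real_field F_fun_has_derivative) (use x t in auto)
    moreover have "(1 - (of_real x)\<^sup>2) powr (- complex_of_real \<alpha>) = of_real ((1 - x\<^sup>2) powr (- \<alpha>))"
      using powr_of_real[OF pos, of "- \<alpha>"] by simp
    ultimately have 1: "((\<lambda>t. F_fun \<alpha> (of_real t)) has_vector_derivative complex_of_real ((1 - x\<^sup>2) powr (- \<alpha>))) (at x)"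
      by (simp only:)
    have "((\<lambda>t. of_real (P_fun \<alpha> t)) has_vector_derivative complex_of_real ((1 - x\<^sup>2) powr (- \<alpha>))) (at x)"
      by (intro has_vector_derivative_of_real P_fun_deriv) (use x t in auto)
    from has_vector_derivative_diff[OF 1 this]
    show "(?d has_vector_derivative 0) (at x)" by simp
  qed (auto intro: derivative_intros)
  then show ?thesis by (simp add: F_fun_0 P_fun_0)
qed

text \<open>The bound is \<open>\<bar>1 - z\<^sup>2\<bar> \<ge> 1 - \<bar>z\<bar>\<^sup>2\<close>; it is attained at \<open>z = 0\<close>.\<close>
lemma bloch_seminorm_F_fun:
  assumes \<alpha>: "0 \<le> \<alpha>"
  shows "F_fun \<alpha> \<in> bloch_space \<alpha>" and "bloch_seminorm \<alpha> (F_fun \<alpha>) = 1"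
proof -
  have bd: "(1 - (cmod z)\<^sup>2) powr \<alpha> * cmod (deriv (F_fun \<alpha>) z) \<le> 1" if z: "cmod z < 1" for z
  proof -
    have pos: "0 < 1 - (cmod z)\<^sup>2" using one_minus_sq_pos[of "cmod z"] z by simp
    have le: "1 - (cmod z)\<^sup>2 \<le> cmod (1 - z\<^sup>2)"
      using norm_triangle_ineq2[of 1 "z\<^sup>2"] by (simp add: norm_power)
    have "cmod (deriv (F_fun \<alpha>) z) = cmod (1 - z\<^sup>2) powr (- \<alpha>)"
      by (simp add: DERIV_imp_deriv[OF F_fun_has_derivative[OF z]] norm_powr_real_powr')
    also have "\<dots> \<le> (1 - (cmod z)\<^sup>2) powr (- \<alpha>)" using pos le \<alpha> by (intro powr_mono2') auto
    finally have "(1 - (cmod z)\<^sup>2) powr \<alpha> * cmod (deriv (F_fun \<alpha>) z) \<le>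
        (1 - (cmod z)\<^sup>2) powr \<alpha> * (1 - (cmod z)\<^sup>2) powr (- \<alpha>)" by (intro mult_left_mono) auto
    also have "\<dots> = 1" using pos by (simp flip: powr_add)
    finally show ?thesis .
  qed
  show sp: "F_fun \<alpha> \<in> bloch_space \<alpha>"
    unfolding bloch_space_def using F_fun_holomorphic bd by (auto intro!: bdd_aboveI2[of _ _ 1])
  have "deriv (F_fun \<alpha>) 0 = 1"
    using DERIV_imp_deriv[OF F_fun_has_derivative[of 0 \<alpha>]] by simp
  then show "bloch_seminorm \<alpha> (F_fun \<alpha>) = 1"
    using bloch_seminorm_upper[OF sp, of 0] bloch_seminorm_le[OF bd] by auto
qed

section \<open>The norm of the Hilbert operator and its extremal functions\<close>

context
  fixes \<alpha> :: real
  assumes \<alpha>1: "1 < \<alpha>" and \<alpha>2: "\<alpha> < 2"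
begin

lemma set_integrable_growth:
  "set_integrable lborel {0..<1} (\<lambda>t. a + b * P_fun \<alpha> t)"
proof (intro set_integral_add set_integrable_mult_right set_integrable_P_fun \<alpha>1 \<alpha>2)
  show "set_integrable lborel {0..<1} (\<lambda>t::real. a)"
    by (rule set_integrable_subset[OF borel_integrable_atLeastAtMost'[of 0 1]]) auto
qed

lemma bloch_growth_norm:
  assumes "f \<in> bloch_space \<alpha>" "t \<in> {0..<1}"
  shows "cmod (f (of_real t)) \<le> cmod (f 0) + bloch_seminorm \<alpha> f * P_fun \<alpha> t"
  using bloch_growth[OF assms] norm_triangle_ineq2[of "f (of_real t)" "f 0"] by linarith

lemma bloch_set_integrable:
  assumes "f \<in> bloch_space \<alpha>"
  shows "set_integrable lborel {0..<1} (\<lambda>t. f (complex_of_real t))"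
  by (rule set_integrable_continuous_bound[OF bloch_space_continuous[OF assms] set_integrable_growth bloch_growth_norm[OF assms]])

lemma bloch_hilbert_integrable:
  assumes "f \<in> bloch_space \<alpha>" "cmod z < 1"
  shows "hilbert_integrable f z"
  using set_integrable_Cauchy_kernel[OF bloch_set_integrable[OF assms(1)] assms(2), of 1]
  by (simp add: hilbert_integrable_def)

lemma hilbert_op_deriv:
  assumes "f \<in> bloch_space \<alpha>" "cmod z < 1"
  shows "(hilbert_op f has_field_derivative
    (LINT t:{0..<1}|lborel. of_real t * f (of_real t) / (1 - of_real t * z)\<^sup>2)) (at z)"
  using has_field_derivative_Cauchy_integral[OF bloch_set_integrable[OF assms(1)] assms(2), of 1]
  by (simp add: hilbert_op_def[abs_def] power2_eq_square)

lemma hilbert_op_holomorphic: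
  assumes "f \<in> bloch_space \<alpha>" shows "hilbert_op f holomorphic_on ball 0 1"
  unfolding holomorphic_on_def
proof
  fix z :: complex assume "z \<in> ball 0 1"
  then have "(hilbert_op f has_field_derivative
      (LINT t:{0..<1}|lborel. of_real t * f (of_real t) / (1 - of_real t * z)\<^sup>2)) (at z)"
    by (intro hilbert_op_deriv[OF assms]) simp
  then show "hilbert_op f field_differentiable at z within ball 0 1"
    using field_differentiable_at_within field_differentiable_def by blast
qed

lemma C_const_nonneg: "0 \<le> C_const \<alpha>"
  unfolding C_const_eq_integral_P_fun[OF \<alpha>1 \<alpha>2] set_lebesgue_integral_def
  by (intro Bochner_Integration.integral_nonneg) (auto simp: indicator_def P_fun_nonneg)

lemma hilbert_op_0_bound:
  assumes f: "f \<in> bloch_space \<alpha>"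
  shows "cmod (hilbert_op f 0) \<le> cmod (f 0) + bloch_seminorm \<alpha> f * C_const \<alpha>"
proof -
  let ?I = "\<lambda>f. LINT t:{0..<1}|lborel. f t"
  have c: "set_integrable lborel {0..<1} (\<lambda>t::real. cmod (f 0))" using set_integrable_growth[of "cmod (f 0)" 0] by simp
  have "cmod (hilbert_op f 0) \<le> (LINT t:{0..<1}|lborel. cmod (f (of_real t)))"
    using set_integral_norm_bound[OF bloch_set_integrable[OF f]] by (simp add: hilbert_op_def)
  also have "\<dots> \<le> (LINT t:{0..<1}|lborel. cmod (f 0) + bloch_seminorm \<alpha> f * P_fun \<alpha> t)"
    by (intro set_integral_mono set_integrable_growth bloch_growth_norm[OF f] set_integrable_norm[OF bloch_set_integrable[OF f]])
  also have "\<dots> = (LINT t:{0..<1::real}|lborel. cmod (f 0) * (1 / (1 - 0 * t)\<^sup>2)) + bloch_seminorm \<alpha> f * C_const \<alpha>"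
    using set_integral_add(2)[OF c set_integrable_mult_right[OF set_integrable_P_fun[OF \<alpha>1 \<alpha>2], of "bloch_seminorm \<alpha> f"]]
    by (simp add: C_const_eq_integral_P_fun[OF \<alpha>1 \<alpha>2])
  also have "\<dots> = cmod (f 0) * (1 / (1 - 0)) + bloch_seminorm \<alpha> f * C_const \<alpha>"
    using set_integral_one_over_square(2)[of 0] by (simp only: set_integral_mult_right)
  finally show ?thesis by simp
qed

text \<open>The constant 2 comes from \<open>(1 - r\<^sup>2) powr \<alpha> / (1 - r) = (1 + r) * (1 - r\<^sup>2) powr (\<alpha> - 1) \<le> 2\<close>.\<close>
lemma hilbert_op_deriv_bound:
  assumes f: "f \<in> bloch_space \<alpha>" and z: "cmod z < 1"
  shows "(1 - (cmod z)\<^sup>2) powr \<alpha> * cmod (deriv (hilbert_op f) z) \<le>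
    2 * cmod (f 0) + bloch_seminorm \<alpha> f * D_fun \<alpha> (cmod z)"
proof -
  let ?I = "\<lambda>f. LINT t:{0..<1}|lborel. f t"
  define r where "r = cmod z"
  define s where "s = bloch_seminorm \<alpha> f"
  have r: "0 \<le> r" "r < 1" "\<bar>r\<bar> < 1" using z by (auto simp: r_def)
  have pos: "0 < 1 - r\<^sup>2" using one_minus_sq_pos r by blast
  let ?g = "\<lambda>t. of_real t * f (of_real t) / (1 - of_real t * z)\<^sup>2"
  have ig: "set_integrable lborel {0..<1} ?g"
    using set_integrable_Cauchy_kernel[OF set_integrable_mult_continuous[OF bloch_set_integrable[OF f], of of_real] z, of 2]
    by (simp add: mult.commute continuous_intros)
  note i1 = set_integral_one_over_square[OF r(1,2)]
  have iP: "set_integrable lborel {0..<1} (\<lambda>t. t * P_fun \<alpha> t / (1 - r * t)\<^sup>2)"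
    using set_integrable_Cauchy_kernel_mult[OF set_integrable_P_fun[OF \<alpha>1 \<alpha>2] _ r(3), of "\<lambda>t. t" 2] by (simp add: mult.commute continuous_intros)
  note i2 = set_integrable_mult_right[OF i1(1), of "cmod (f 0)"] set_integrable_mult_right[OF iP, of s]
  have "cmod (deriv (hilbert_op f) z) \<le> ?I (\<lambda>t. cmod (?g t))"
    unfolding DERIV_imp_deriv[OF hilbert_op_deriv[OF f z]] by (rule set_integral_norm_bound[OF ig])
  also have "\<dots> \<le> ?I (\<lambda>t. cmod (f 0) * (1 / (1 - r * t)\<^sup>2) + s * (t * P_fun \<alpha> t / (1 - r * t)\<^sup>2))"
  proof (rule set_integral_mono)
    show "set_integrable lborel {0..<1} (\<lambda>t. cmod (?g t))" by (rule set_integrable_norm[OF ig])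
    show "set_integrable lborel {0..<1} (\<lambda>t. cmod (f 0) * (1 / (1 - r * t)\<^sup>2) + s * (t * P_fun \<alpha> t / (1 - r * t)\<^sup>2))"
      by (intro set_integral_add i2)
    fix t :: real assume t: "t \<in> {0..<1}"
    have den: "0 < 1 - r * t" using one_minus_mult_pos[of r t] r t by auto
    have "1 - r * t \<le> cmod (1 - of_real t * z)"
      using norm_triangle_ineq2[of 1 "of_real t * z"] t by (simp add: norm_mult r_def mult.commute)
    then have d: "(1 - r * t)\<^sup>2 \<le> (cmod (1 - of_real t * z))\<^sup>2" using den by (intro power_mono) auto
    have "t * cmod (f (of_real t)) \<le> t * (cmod (f 0) + s * P_fun \<alpha> t)"
      using bloch_growth_norm[OF f t] t unfolding s_def by (intro mult_left_mono) auto
    also have "\<dots> \<le> cmod (f 0) + s * (t * P_fun \<alpha> t)"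
      using t mult_left_le_one_le[of "cmod (f 0)" t] by (simp add: algebra_simps)
    finally have n: "t * cmod (f (of_real t)) \<le> cmod (f 0) + s * (t * P_fun \<alpha> t)" .
    have "cmod (?g t) = t * cmod (f (of_real t)) / (cmod (1 - of_real t * z))\<^sup>2"
      using t by (simp add: norm_divide norm_mult norm_power)
    also have "\<dots> \<le> (cmod (f 0) + s * (t * P_fun \<alpha> t)) / (1 - r * t)\<^sup>2"
      using n d den t by (intro frac_le order_trans[OF _ n]) auto
    finally show "cmod (?g t) \<le> cmod (f 0) * (1 / (1 - r * t)\<^sup>2) + s * (t * P_fun \<alpha> t / (1 - r * t)\<^sup>2)"
      by (simp add: add_divide_distrib)
  qed
  also have "\<dots> = cmod (f 0) * (1 / (1 - r)) + s * ?I (\<lambda>t. t * P_fun \<alpha> t / (1 - r * t)\<^sup>2)"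
    using set_integral_add(2)[OF i2] i1(2) by (simp only: set_integral_mult_right)
  finally have "(1 - r\<^sup>2) powr \<alpha> * cmod (deriv (hilbert_op f) z) \<le>
      (1 - r\<^sup>2) powr \<alpha> * (cmod (f 0) * (1 / (1 - r)) + s * ?I (\<lambda>t. t * P_fun \<alpha> t / (1 - r * t)\<^sup>2))"
    by (intro mult_left_mono) auto
  also have "\<dots> = cmod (f 0) * ((1 - r\<^sup>2) powr \<alpha> * (1 / (1 - r))) + s * D_fun \<alpha> r"
    by (simp add: D_fun_def algebra_simps)
  also have "\<dots> \<le> cmod (f 0) * 2 + s * D_fun \<alpha> r"
  proof -
    have "(1 - r\<^sup>2) powr \<alpha> * (1 / (1 - r)) = (1 + r) * (1 - r\<^sup>2) powr (\<alpha> - 1)"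
      using r by (simp only: one_minus_sq_powr_divide)
    also have "\<dots> \<le> 2 * 1" using r pos \<alpha>1 by (intro mult_mono powr_le1) auto
    finally have "(1 - r\<^sup>2) powr \<alpha> * (1 / (1 - r)) \<le> 2" by simp
    from mult_left_mono[OF this norm_ge_zero[of "f 0"]] show ?thesis by simp
  qed
  finally show ?thesis unfolding r_def s_def by (simp add: mult.commute)
qed

lemma hilbert_op_seminorm_bound:
  assumes f: "f \<in> bloch_space \<alpha>"
  shows "hilbert_op f \<in> bloch_space \<alpha>"
    and "bloch_seminorm \<alpha> (hilbert_op f) \<le>
      2 * cmod (f 0) + bloch_seminorm \<alpha> f * (SUP r\<in>{0..<1}. D_fun \<alpha> r)"
proof -
  let ?S = "SUP r\<in>{0..<1}. D_fun \<alpha> r"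
  have bd: "(1 - (cmod z)\<^sup>2) powr \<alpha> * cmod (deriv (hilbert_op f) z) \<le>
      2 * cmod (f 0) + bloch_seminorm \<alpha> f * ?S" if "cmod z < 1" for z
  proof -
    have "D_fun \<alpha> (cmod z) \<le> ?S"
      by (rule cSUP_upper[OF _ D_fun_bdd_above[OF \<alpha>1 \<alpha>2]]) (use that in auto)
    from mult_left_mono[OF this bloch_seminorm_nonneg[OF f]] hilbert_op_deriv_bound[OF f that]
    show ?thesis by linarith
  qed
  show "hilbert_op f \<in> bloch_space \<alpha>"
    unfolding bloch_space_def using hilbert_op_holomorphic[OF f] bd by (auto intro!: bdd_aboveI2)
  show "bloch_seminorm \<alpha> (hilbert_op f) \<le> 2 * cmod (f 0) + bloch_seminorm \<alpha> f * ?S"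
    using bd by (rule bloch_seminorm_le)
qed

lemma hilbert_op_norm_bound:
  assumes f: "f \<in> bloch_space \<alpha>"
  shows "bloch_norm \<alpha> (hilbert_op f) \<le>
    3 * cmod (f 0) + bloch_seminorm \<alpha> f * (C_const \<alpha> + (SUP r\<in>{0..<1}. D_fun \<alpha> r))"
  using hilbert_op_0_bound[OF f] hilbert_op_seminorm_bound(2)[OF f]
  by (simp add: bloch_norm_eq algebra_simps)

text \<open>This strict inequality is what excludes a constant term both from the norm and from the extremal
functions.\<close>
lemma three_less_C_plus_SUP: "3 < C_const \<alpha> + (SUP r\<in>{0..<1}. D_fun \<alpha> r)"
  using C_const_nonneg pi_le_SUP_D_fun[OF \<alpha>1 \<alpha>2] pi_gt3 by linarith

lemma hilbert_op_norm_le: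
  assumes f: "f \<in> bloch_space \<alpha>"
  shows "bloch_norm \<alpha> (hilbert_op f) \<le> (C_const \<alpha> + (SUP r\<in>{0..<1}. D_fun \<alpha> r)) * bloch_norm \<alpha> f"
proof -
  have "3 * cmod (f 0) \<le> (C_const \<alpha> + (SUP r\<in>{0..<1}. D_fun \<alpha> r)) * cmod (f 0)"
    using three_less_C_plus_SUP by (intro mult_right_mono) auto
  then show ?thesis using hilbert_op_norm_bound[OF f] by (simp add: bloch_norm_eq algebra_simps)
qed

lemma extremal_function_norms:
  assumes c: "cmod c = 1" and f: "\<And>z. z \<in> ball 0 1 \<Longrightarrow> f z = c * F_fun \<alpha> z"
  shows "f \<in> bloch_space \<alpha>" and "bloch_norm \<alpha> f = 1"
    and "bloch_norm \<alpha> (hilbert_op f) = C_const \<alpha> + (SUP r\<in>{0..<1}. D_fun \<alpha> r)"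
proof -
  let ?I = "\<lambda>f. LINT t:{0..<1}|lborel. f t"
  have \<alpha>0: "0 \<le> \<alpha>" using \<alpha>1 by simp
  note F = bloch_seminorm_F_fun[OF \<alpha>0]
  have f0: "f 0 = 0" using f[of 0] by (simp add: F_fun_0)
  have df: "deriv f z = c * deriv (F_fun \<alpha>) z" if z: "z \<in> ball 0 1" for z
  proof (rule DERIV_imp_deriv)
    have "((\<lambda>w. c * F_fun \<alpha> w) has_field_derivative c * deriv (F_fun \<alpha>) z) (at z)"
      using z by (intro DERIV_cmult bloch_space_deriv[OF F(1)]) auto
    then show "(f has_field_derivative c * deriv (F_fun \<alpha>) z) (at z)"
      by (rule has_field_derivative_transform_within_open[of _ _ _ "ball 0 1"]) (use z f in auto)
  qed
  have eq: "(\<lambda>z. (1 - (cmod z)\<^sup>2) powr \<alpha> * cmod (deriv f z)) ` ball 0 1 =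
      (\<lambda>z. (1 - (cmod z)\<^sup>2) powr \<alpha> * cmod (deriv (F_fun \<alpha>) z)) ` ball 0 1"
    by (intro image_cong refl) (simp add: df norm_mult c)
  have "f holomorphic_on ball 0 1"
    by (rule holomorphic_transform[of "\<lambda>z. c * F_fun \<alpha> z"]) (auto intro!: holomorphic_intros F_fun_holomorphic simp: f)
  then show sp: "f \<in> bloch_space \<alpha>" using F(1) by (simp add: bloch_space_def eq)
  have sf: "bloch_seminorm \<alpha> f = 1" using F(2) unfolding bloch_seminorm_def eq .
  then show "bloch_norm \<alpha> f = 1" by (simp add: bloch_norm_eq f0)
  have fP: "f (of_real t) = c * of_real (P_fun \<alpha> t)" if "t \<in> {0..<1}" for t
    using f[of "of_real t"] F_fun_of_real[OF that] that by simp
  have "hilbert_op f 0 = ?I (\<lambda>t. f (of_real t))" by (simp add: hilbert_op_def)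
  also have "\<dots> = ?I (\<lambda>t. c * of_real (P_fun \<alpha> t))"
    by (rule set_lebesgue_integral_cong) (auto simp: fP)
  also have "\<dots> = c * of_real (C_const \<alpha>)"
    by (simp add: C_const_eq_integral_P_fun[OF \<alpha>1 \<alpha>2] set_integral_complex_of_real)
  finally have H0: "cmod (hilbert_op f 0) = C_const \<alpha>" using c C_const_nonneg by (simp add: norm_mult)
  have D: "D_fun \<alpha> r \<le> bloch_seminorm \<alpha> (hilbert_op f)" if r: "r \<in> {0..<1}" for r
  proof -
    have rz: "cmod (of_real r) < 1" using r by simp
    have "deriv (hilbert_op f) (of_real r) = ?I (\<lambda>t. of_real t * f (of_real t) / (1 - of_real t * of_real r)\<^sup>2)"
      by (rule DERIV_imp_deriv[OF hilbert_op_deriv[OF sp rz]])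
    also have "\<dots> = ?I (\<lambda>t. c * of_real (t * P_fun \<alpha> t / (1 - r * t)\<^sup>2))"
      by (rule set_lebesgue_integral_cong) (auto simp: fP mult_ac)
    also have "\<dots> = c * of_real (?I (\<lambda>t. t * P_fun \<alpha> t / (1 - r * t)\<^sup>2))"
      by (simp only: set_integral_mult_right set_integral_complex_of_real)
    finally have "\<bar>?I (\<lambda>t. t * P_fun \<alpha> t / (1 - r * t)\<^sup>2)\<bar> = cmod (deriv (hilbert_op f) (of_real r))"
      using c by (simp add: norm_mult)
    then have "D_fun \<alpha> r \<le> (1 - (cmod (of_real r))\<^sup>2) powr \<alpha> * cmod (deriv (hilbert_op f) (of_real r))"
      unfolding D_fun_def using r by (auto intro!: mult_left_mono)
    also have "\<dots> \<le> bloch_seminorm \<alpha> (hilbert_op f)"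
      by (rule bloch_seminorm_upper[OF hilbert_op_seminorm_bound(1)[OF sp] rz])
    finally show ?thesis .
  qed
  have "(SUP r\<in>{0..<1}. D_fun \<alpha> r) \<le> bloch_seminorm \<alpha> (hilbert_op f)"
    by (rule cSUP_least) (use D in auto)
  moreover have "bloch_seminorm \<alpha> (hilbert_op f) \<le> (SUP r\<in>{0..<1}. D_fun \<alpha> r)"
    using hilbert_op_seminorm_bound(2)[OF sp] by (simp add: f0 sf)
  ultimately show "bloch_norm \<alpha> (hilbert_op f) = C_const \<alpha> + (SUP r\<in>{0..<1}. D_fun \<alpha> r)"
    by (simp add: bloch_norm_eq H0)
qed

lemma bloch_opnorm_hilbert_op:
  "bloch_opnorm \<alpha> hilbert_op = C_const \<alpha> + (SUP r\<in>{0..<1}. D_fun \<alpha> r)"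
proof -
  let ?N = "C_const \<alpha> + (SUP r\<in>{0..<1}. D_fun \<alpha> r)"
  let ?B = "{f \<in> bloch_space \<alpha>. bloch_norm \<alpha> f \<le> 1}"
  note F = extremal_function_norms[of 1 "F_fun \<alpha>", simplified]
  have le: "bloch_norm \<alpha> (hilbert_op f) \<le> ?N" if "f \<in> ?B" for f
  proof -
    have "bloch_norm \<alpha> (hilbert_op f) \<le> ?N * bloch_norm \<alpha> f"
      using that by (intro hilbert_op_norm_le) auto
    also have "\<dots> \<le> ?N * 1" using that three_less_C_plus_SUP by (intro mult_left_mono) auto
    finally show ?thesis by simp
  qed
  have mem: "F_fun \<alpha> \<in> ?B" using F by simp
  have "bloch_norm \<alpha> (hilbert_op (F_fun \<alpha>)) \<le> bloch_opnorm \<alpha> hilbert_op"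
    unfolding bloch_opnorm_def by (rule cSUP_upper[OF mem]) (use le in \<open>auto intro!: bdd_aboveI2[of _ _ ?N]\<close>)
  moreover have "bloch_opnorm \<alpha> hilbert_op \<le> ?N"
    unfolding bloch_opnorm_def by (rule cSUP_least) (use le mem in blast)+
  ultimately show ?thesis using F(3) by simp
qed

lemma hilbert_op_bounded: "bloch_bounded \<alpha> hilbert_op"
  unfolding bloch_bounded_def using hilbert_op_seminorm_bound(1) hilbert_op_norm_le by blast

text \<open>In \<open>hilbert_op_norm_bound\<close> a nonzero \<open>f 0\<close> would lose strictly, so \<open>f 0 = 0\<close> and the seminorm is 1.
Both remaining estimates must then be equalities, and the one at 0 reads \<open>\<bar>\<integral>f\<bar> = \<integral>P_fun \<alpha>\<close> although
\<open>\<bar>f\<bar> \<le> P_fun \<alpha>\<close>.  After a rotation, \<open>P_fun \<alpha> - Re f\<close> is continuous and nonnegative with integral 0,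
which determines \<open>f\<close> on \<open>[0,1)\<close> and hence, by analytic continuation, on the disc.\<close>
lemma extremal_function_unique:
  assumes f: "f \<in> bloch_space \<alpha>" and n1: "bloch_norm \<alpha> f = 1"
    and ext: "bloch_norm \<alpha> (hilbert_op f) = C_const \<alpha> + (SUP r\<in>{0..<1}. D_fun \<alpha> r)"
  obtains c where "cmod c = 1" "\<And>z. z \<in> ball 0 1 \<Longrightarrow> f z = c * F_fun \<alpha> z"
proof -
  let ?N = "C_const \<alpha> + (SUP r\<in>{0..<1}. D_fun \<alpha> r)"
  have s: "bloch_seminorm \<alpha> f = 1 - cmod (f 0)" using n1 by (simp add: bloch_norm_eq)
  have "?N \<le> 3 * cmod (f 0) + (1 - cmod (f 0)) * ?N"
    using hilbert_op_norm_bound[OF f] unfolding ext s .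
  then have "cmod (f 0) * (?N - 3) \<le> 0" by (simp add: algebra_simps)
  then have f0: "f 0 = 0" using three_less_C_plus_SUP by (simp add: mult_le_0_iff)
  then have s1: "bloch_seminorm \<alpha> f = 1" using s by simp
  have "cmod (hilbert_op f 0) \<le> C_const \<alpha>" "bloch_seminorm \<alpha> (hilbert_op f) \<le> (SUP r\<in>{0..<1}. D_fun \<alpha> r)"
    using hilbert_op_0_bound[OF f] hilbert_op_seminorm_bound(2)[OF f] by (simp_all add: f0 s1)
  then have H0: "cmod (hilbert_op f 0) = C_const \<alpha>" using ext by (simp add: bloch_norm_eq)
  obtain c where c: "cmod c = 1" "hilbert_op f 0 = c * of_real (C_const \<alpha>)"
  proof (cases "C_const \<alpha> = 0")
    case True
    then show ?thesis using H0 by (intro that[of 1]) auto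
  next
    case False
    then show ?thesis using H0 C_const_nonneg
      by (intro that[of "hilbert_op f 0 / of_real (C_const \<alpha>)"]) (auto simp: norm_divide)
  qed
  have cc: "cnj c * c = 1" using c(1) by (simp add: complex_norm_square[symmetric] mult.commute)
  define g where "g t = cnj c * f (of_real t)" for t
  have ig: "set_integrable lborel {0..<1} g"
    unfolding g_def by (rule set_integrable_mult_right[OF bloch_set_integrable[OF f]])
  have iR: "set_integrable lborel {0..<1} (\<lambda>t. Re (g t))"
    using ig unfolding set_integrable_def by (auto dest: integrable_Re)
  have "(LINT t:{0..<1}|lborel. g t) = cnj c * hilbert_op f 0"
    by (simp add: g_def hilbert_op_def)
  also have "\<dots> = of_real (C_const \<alpha>)" using cc by (simp add: c(2) mult.assoc[symmetric])
  finally have Ig: "(LINT t:{0..<1}|lborel. g t) = of_real (C_const \<alpha>)" .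
  have IR: "(LINT t:{0..<1}|lborel. Re (g t)) = C_const \<alpha>"
    using ig arg_cong[OF Ig, of Re] unfolding set_lebesgue_integral_def set_integrable_def
    by (subst (asm) integral_Re[symmetric]) auto
  have gP: "cmod (g t) \<le> P_fun \<alpha> t" if "t \<in> {0..<1}" for t
    using bloch_growth[OF f that] c(1) by (simp add: f0 s1 g_def norm_mult)
  have eq: "P_fun \<alpha> t - Re (g t) = 0" if t: "t \<in> {0..<1}" for t
  proof (rule continuous_nonneg_integral_0_imp_0[OF _ _ _ _ t])
    show "continuous_on {0..<1} (\<lambda>t. P_fun \<alpha> t - Re (g t))"
      unfolding g_def by (intro continuous_intros continuous_on_P_fun bloch_space_continuous[OF f])
    show "set_integrable lborel {0..<1} (\<lambda>t. P_fun \<alpha> t - Re (g t))"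
      by (intro set_integral_diff set_integrable_P_fun \<alpha>1 \<alpha>2 iR)
    show "0 \<le> P_fun \<alpha> t - Re (g t)" if "t \<in> {0..<1}" for t
      using gP[OF that] complex_Re_le_cmod[of "g t"] by linarith
    show "(LINT t:{0..<1}|lborel. P_fun \<alpha> t - Re (g t)) = 0"
      using set_integral_diff(2)[OF set_integrable_P_fun[OF \<alpha>1 \<alpha>2] iR]
      by (simp add: IR C_const_eq_integral_P_fun[OF \<alpha>1 \<alpha>2])
  qed
  have fF: "f (of_real t) = c * F_fun \<alpha> (of_real t)" if t: "t \<in> {0..<1}" for t
  proof -
    have "cmod (g t) \<le> Re (g t)" using gP[OF t] eq[OF t] by simp
    then have "cmod (g t) = Re (g t)" using complex_Re_le_cmod[of "g t"] by linarith
    then have "Im (g t) = 0" using cmod_power2[of "g t"] by simp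
    then have "g t = of_real (P_fun \<alpha> t)" using eq[OF t] by (simp add: complex_eq_iff)
    then have "c * (cnj c * f (of_real t)) = c * of_real (P_fun \<alpha> t)" by (simp add: g_def)
    then show ?thesis using cc by (simp add: F_fun_of_real[OF t] mult.assoc[symmetric] mult.commute[of c "cnj c"])
  qed
  have "f z = c * F_fun \<alpha> z" if z: "z \<in> ball 0 1" for z
  proof -
    have "f z - c * F_fun \<alpha> z = 0"
    proof (rule analytic_continuation[of "\<lambda>z. f z - c * F_fun \<alpha> z" "ball 0 1" "of_real ` {0..<1}" 0])
      show "(\<lambda>z. f z - c * F_fun \<alpha> z) holomorphic_on ball 0 1"
        using f by (intro holomorphic_intros F_fun_holomorphic) (auto simp: bloch_space_def)
      show "(0::complex) islimpt of_real ` {0..<1}"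
        unfolding islimpt_approachable
      proof (intro allI impI)
        fix e :: real assume "0 < e"
        then show "\<exists>x'\<in>of_real ` {0..<1}. x' \<noteq> (0::complex) \<and> dist x' 0 < e"
          by (intro bexI[of _ "of_real (min e 1 / 2)"] imageI) (auto simp: min_def norm_divide)
      qed
    qed (use z fF in auto)
    then show ?thesis by simp
  qed
  with c(1) show ?thesis using that by blast
qed

end

theorem theorem1p1:
  fixes \<alpha> :: real
  assumes "1 < \<alpha>" and "\<alpha> < 2"
  shows
    "(\<forall>f\<in>bloch_space \<alpha>. \<forall>z\<in>ball 0 1. hilbert_integrable f z) \<and>
     bloch_bounded \<alpha> hilbert_op \<and>
     bdd_above (D_fun \<alpha> ` {0..<1}) \<and>
     bloch_opnorm \<alpha> hilbert_op = C_const \<alpha> + (SUP r\<in>{0..<1}. D_fun \<alpha> r) \<and>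
     (\<forall>f. (f \<in> bloch_space \<alpha> \<and> bloch_norm \<alpha> f = 1 \<and>
            bloch_norm \<alpha> (hilbert_op f) = bloch_opnorm \<alpha> hilbert_op) \<longleftrightarrow>
          (\<exists>c. cmod c = 1 \<and> (\<forall>z\<in>ball 0 1. f z = c * F_fun \<alpha> z))) \<and>
     C_const \<alpha> = 1 / (2 * (\<alpha> - 1)) + sqrt pi / 2 * gamma_quotient \<alpha> \<and>
     (\<alpha> \<le> 3/2 \<longrightarrow>
        bloch_opnorm \<alpha> hilbert_op = C_const \<alpha> + pi / sin (pi * (\<alpha> - 1))) \<and>
     bloch_opnorm (3/2) hilbert_op = 1 + pi \<and>
     (3/2 < \<alpha> \<longrightarrow>
        (\<exists>E. continuous_on {0..1} E \<and> (\<forall>r\<in>{0..<1}. E r = D_fun \<alpha> r) \<and>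
             E 1 = pi / sin (pi * (\<alpha> - 1)) \<and>
             (SUP r\<in>{0..<1}. D_fun \<alpha> r) > E 1) \<and>
        (\<exists>r\<in>{0<..<1}. D_fun \<alpha> r = (SUP s\<in>{0..<1}. D_fun \<alpha> s)))"
proof (intro conjI impI)
  note \<alpha> = assms
  show "\<forall>f\<in>bloch_space \<alpha>. \<forall>z\<in>ball 0 1. hilbert_integrable f z"
    using bloch_hilbert_integrable[OF \<alpha>] by auto
  show "bloch_bounded \<alpha> hilbert_op" by (rule hilbert_op_bounded[OF \<alpha>])
  show "bdd_above (D_fun \<alpha> ` {0..<1})" by (rule D_fun_bdd_above[OF \<alpha>])
  show opnorm: "bloch_opnorm \<alpha> hilbert_op = C_const \<alpha> + (SUP r\<in>{0..<1}. D_fun \<alpha> r)"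
    by (rule bloch_opnorm_hilbert_op[OF \<alpha>])
  show "\<forall>f. (f \<in> bloch_space \<alpha> \<and> bloch_norm \<alpha> f = 1 \<and>
            bloch_norm \<alpha> (hilbert_op f) = bloch_opnorm \<alpha> hilbert_op) \<longleftrightarrow>
          (\<exists>c. cmod c = 1 \<and> (\<forall>z\<in>ball 0 1. f z = c * F_fun \<alpha> z))"
    unfolding opnorm
    by (meson extremal_function_norms[OF \<alpha>] extremal_function_unique[OF \<alpha>])
  show "C_const \<alpha> = 1 / (2 * (\<alpha> - 1)) + sqrt pi / 2 * gamma_quotient \<alpha>"
    by (rule C_const_eq_gamma_quotient[OF \<alpha>])
  show "bloch_opnorm \<alpha> hilbert_op = C_const \<alpha> + pi / sin (pi * (\<alpha> - 1))" if "\<alpha> \<le> 3/2"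
    unfolding opnorm SUP_D_fun_eq[OF \<alpha> that] ..
  have "C_const (3/2) = 1" using C_const_eq_sq_powr_integral[of "3/2"] by simp
  moreover have "pi / sin (pi * (3/2 - 1)) = pi" by simp
  ultimately show "bloch_opnorm (3/2) hilbert_op = 1 + pi"
    using bloch_opnorm_hilbert_op[of "3/2"] SUP_D_fun_eq[of "3/2"] by simp
  assume gt: "3/2 < \<alpha>"
  show "\<exists>E. continuous_on {0..1} E \<and> (\<forall>r\<in>{0..<1}. E r = D_fun \<alpha> r) \<and>
             E 1 = pi / sin (pi * (\<alpha> - 1)) \<and> (SUP r\<in>{0..<1}. D_fun \<alpha> r) > E 1"
    using D_fun_extension[OF \<alpha>] SUP_D_fun_gt[OF \<alpha> gt] by metis
  show "\<exists>r\<in>{0<..<1}. D_fun \<alpha> r = (SUP s\<in>{0..<1}. D_fun \<alpha> s)"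
    by (rule SUP_D_fun_attained[OF \<alpha> gt])
qed

end
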